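(* Let the horizontal data $\{p:(L,h)\to(M,g_M),\ I\}$ be $\sigma$-constant, with $\dim_{\mathbf C}M=m$, and let $Q(\tau)=\omega_M(\tau)^m/\omega_M^m$. Then the scalar curvature $\sigma_M(\tau)$ of $g_M(\tau)$ satisfies $\sigma_M(\tau)=P(\tau)/2Q(\tau)$, where $P$ is a polynomial in $\tau$, and for each momentum profile $\varphi$ on $I$ the scalar curvature of the bundle-adapted metric $g_\varphi$ is $$\sigma_\varphi=\frac1{2Q}\Bigl(P-(Q\varphi)''\Bigr)(\tau).$$
   Context: Conventions: a Kähler metric with local components $g_{i\bar\jmath}$ has Kähler form $\omega=\frac{\sqrt{-1}}2\sum g_{i\bar\jmath}\,dz^i\wedge d\bar z^j$ and Ricci form $\rho=-\sqrt{-1}\,\partial\bar\partial\log\det(g_{i\bar\jmath})$. Its scalar curvature is the trace of the endomorphism $\omega^{-1}\rho$ of $T^{1,0}$ (so $\rho=\lambda\omega$ in dimension $N$ gives scalar curvature $N\lambda$). $p:(L,h)\to(M,g_M)$ is an Hermitian holomorphic line bundle over a Kähler manifold with Kähler form $\omega_M$. Its curvature form is $\gamma=-\sqrt{-1}\,\partial\bar\partial\log h$, where $h$ also denotes the local function such that the squared norm on $L$ is $r=|z^0|^2h(z)$, $z^0$ being a linear fibre coordinate. Horizontal data $\{p:(L,h)\to(M,g_M),I\}$ consist of such a bundle together with an interval $I\subset\mathbf R$ such that $\omega_M(\tau):=\omega_M-\tau\gamma$ is positive for every $\tau\in I$; the corresponding metric is $g_M(\tau)$. The data are $\sigma$-constant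 if (i) the curvature endomorphism $\mathrm B=\omega_M^{-1}\gamma$ of $T^{1,0}M$ has constant eigenvalues on $M$, and (ii) $g_M(\tau)$ has constant scalar curvature for each $\tau\in I$. (In this case $Q$ depends only on $\tau$.) A momentum profile is a function $\varphi$ that is smooth on the closure of $I$ and positive on the interior of $I$. Momentum construction: let $(a,b)$ be the interior of $I$, fix $\tau_0\in(a,b)$, and set $t_1=\lim_{\tau\to a^+}\int_{\tau_0}^\tau dx/\varphi(x)$ and $t_2=\lim_{\tau\to b^-}\int_{\tau_0}^\tau dx/\varphi(x)$. For $t\in(t_1,t_2)$ define $\mu(t)$ and $f(t)$ by $t=\int_{\tau_0}^{\mu(t)}\frac{dx}{\varphi(x)}$ and $f(t)=\int_{\tau_0}^{\mu(t)}\frac{x\,dx}{\varphi(x)}$. Let $t=\frac12\log r$ be the logarithm of the norm function on $L$ minus its zero section. The bundle-adapted metric $g_\varphi$ is the Kähler metric on $\{t_1<t<t_2\}$ with Kähler form $\omega_\varphi=p^*\omega_M+2\sqrt{-1}\,\partial\bar\partial f(t)$. Functions of $\tau$ are regarded as functions on this domain via $\tau=\mu(t)$, which is a moment map for the circle action rotating the fibres. *)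

theory Defs
  imports "HOL-Analysis.Analysis" "HOL-Computational_Algebra.Computational_Algebra"
begin

section \<open>Calculus on open subsets of complex Euclidean space\<close>

primrec ck_on :: "nat \<Rightarrow> 'v::real_normed_vector set \<Rightarrow> ('v \<Rightarrow> 'w::real_normed_vector) \<Rightarrow> bool" where
  "ck_on 0 S f \<longleftrightarrow> continuous_on S f"
| "ck_on (Suc k) S f \<longleftrightarrow>
     (\<forall>x\<in>S. f differentiable (at x)) \<and> (\<forall>v. ck_on k S (\<lambda>x. frechet_derivative f (at x) v))"

text \<open>Meant for open \<open>S\<close>, and with respect to the underlying real structure.\<close>

definition smooth_on :: "'v::real_normed_vector set \<Rightarrow> ('v \<Rightarrow> 'w::real_normed_vector) \<Rightarrow> bool" where
  "smooth_on S f \<longleftrightarrow> (\<forall>k. ck_on k S f)"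

definition holomorphic_fun_on :: "(complex^'n) set \<Rightarrow> (complex^'n \<Rightarrow> complex) \<Rightarrow> bool" where
  "holomorphic_fun_on S f \<longleftrightarrow>
     (\<forall>z\<in>S. \<exists>D. (f has_derivative D) (at z) \<and> (\<forall>a v. D (a *s v) = a * D v))"

definition holomorphic_map_on :: "(complex^'n) set \<Rightarrow> (complex^'n \<Rightarrow> complex^'k) \<Rightarrow> bool" where
  "holomorphic_map_on S F \<longleftrightarrow> (\<forall>i. holomorphic_fun_on S (\<lambda>z. F z $ i))"

text \<open>The Wirtinger derivatives: \<open>axis i 1\<close> and \<open>axis i \<i>\<close> are the real coordinate directions
  of the \<open>i\<close>-th complex coordinate.\<close>

definition del :: "'n \<Rightarrow> (complex^'n \<Rightarrow> complex) \<Rightarrow> complex^'n \<Rightarrow> complex" where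
  "del i u z =
     (frechet_derivative u (at z) (axis i 1) - \<i> * frechet_derivative u (at z) (axis i \<i>)) / 2"

definition delbar :: "'n \<Rightarrow> (complex^'n \<Rightarrow> complex) \<Rightarrow> complex^'n \<Rightarrow> complex" where
  "delbar i u z =
     (frechet_derivative u (at z) (axis i 1) + \<i> * frechet_derivative u (at z) (axis i \<i>)) / 2"

section \<open>Forms of type (1,1) and Hermitian metrics in coordinates\<close>

text \<open>Every (1,1)-form is represented by its matrix \<open>a\<close> of components in the normalisation
  \<open>(\<i>/2) \<Sum> a $ i $ j dz\<^sup>i \<and> dzbar\<^sup>j\<close>.  A Hermitian metric and its Kaehler form therefore have
  the same matrix, and the form \<open>\<i> \<partial>\<partial>bar u\<close> acquires a factor 2.\<close>

definition i_ddbar :: "(complex^'n \<Rightarrow> complex) \<Rightarrow> complex^'n \<Rightarrow> complex^'n^'n" where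
  "i_ddbar u z = (\<chi> i j. 2 * del i (delbar j u) z)"

definition positive_herm :: "complex^'n^'n \<Rightarrow> bool" where
  "positive_herm a \<longleftrightarrow>
     (\<forall>i j. a $ i $ j = cnj (a $ j $ i)) \<and>
     (\<forall>v. v \<noteq> 0 \<longrightarrow> 0 < Re (\<Sum>i\<in>UNIV. \<Sum>j\<in>UNIV. v $ i * a $ i $ j * cnj (v $ j)))"

definition pullback :: "(complex^'k \<Rightarrow> complex^'n) \<Rightarrow> (complex^'n \<Rightarrow> complex^'n^'n)
    \<Rightarrow> complex^'k \<Rightarrow> complex^'k^'k" where
  "pullback F a z =
     (\<chi> i j. \<Sum>k\<in>UNIV. \<Sum>l\<in>UNIV.
        del i (\<lambda>w. F w $ k) z * a (F z) $ k $ l * cnj (del j (\<lambda>w. F w $ l) z))"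

text \<open>The endomorphism \<open>B = \<omega>\<inverse>\<alpha>\<close> of \<open>T\<^sup>1\<^sup>,\<^sup>0\<close> is characterised by \<open>\<alpha>(X, Y) = \<omega>(B X, Y)\<close>, that is
  \<open>\<alpha> $ i $ j = (\<Sum>k. B $ k $ i * g $ k $ j)\<close>, where \<open>B\<close> acts on column vectors.\<close>

definition form_endo :: "complex^'n^'n \<Rightarrow> complex^'n^'n \<Rightarrow> complex^'n^'n" where
  "form_endo g \<alpha> = transpose (\<alpha> ** matrix_inv g)"

text \<open>The determinant of a positive Hermitian matrix is a positive real number; \<open>Re\<close> only adjusts
  its type.\<close>

definition ricci_form :: "(complex^'n \<Rightarrow> complex^'n^'n) \<Rightarrow> complex^'n \<Rightarrow> complex^'n^'n" where
  "ricci_form g z = - i_ddbar (\<lambda>w. complex_of_real (ln (Re (det (g w))))) z"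

definition scalar_curvature :: "(complex^'n \<Rightarrow> complex^'n^'n) \<Rightarrow> complex^'n \<Rightarrow> complex" where
  "scalar_curvature g z = trace (form_endo (g z) (ricci_form g z))"

definition charpoly :: "complex^'n^'n \<Rightarrow> complex poly" where
  "charpoly A = det (\<chi> i j. (if i = j then [:0, 1:] else 0) - [:A $ i $ j:])"

text \<open>Eigenvalues are counted with algebraic multiplicity.\<close>

definition eigenvalues :: "complex^'n^'n \<Rightarrow> complex multiset" where
  "eigenvalues A = proots (charpoly A)"

section \<open>Complex manifolds and Kaehler metrics\<close>

type_synonym ('p, 'n) chart = "'p set \<times> ('p \<Rightarrow> complex^'n)"

abbreviation chart_inv :: "('p, 'n::finite) chart \<Rightarrow> complex^'n \<Rightarrow> 'p" where
  "chart_inv c \<equiv> inv_into (fst c) (snd c)"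

definition complex_manifold :: "'p topology \<Rightarrow> ('p, 'n::finite) chart set \<Rightarrow> bool" where
  "complex_manifold X \<A> \<longleftrightarrow>
     Hausdorff_space X \<and> second_countable X \<and>
     (\<Union>c\<in>\<A>. fst c) = topspace X \<and>
     (\<forall>c\<in>\<A>. openin X (fst c) \<and> open (snd c ` fst c) \<and>
        homeomorphic_map (subtopology X (fst c)) (top_of_set (snd c ` fst c)) (snd c)) \<and>
     (\<forall>c\<in>\<A>. \<forall>d\<in>\<A>. holomorphic_map_on (snd c ` (fst c \<inter> fst d)) (snd d \<circ> chart_inv c))"

text \<open>A metric on a manifold is the family of its component matrices \<open>g c\<close>, indexed by the charts
  \<open>c\<close>, subject to the transformation law of a tensor.  The last condition says that the Kaehler
  form is closed.\<close>

definition kaehler_metric ::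
    "('p, 'n::finite) chart set \<Rightarrow> (('p, 'n) chart \<Rightarrow> complex^'n \<Rightarrow> complex^'n^'n) \<Rightarrow> bool" where
  "kaehler_metric \<A> g \<longleftrightarrow>
     (\<forall>c\<in>\<A>. smooth_on (snd c ` fst c) (g c)) \<and>
     (\<forall>c\<in>\<A>. \<forall>z\<in>snd c ` fst c. positive_herm (g c z)) \<and>
     (\<forall>c\<in>\<A>. \<forall>d\<in>\<A>. \<forall>z\<in>snd c ` (fst c \<inter> fst d).
        g c z = pullback (snd d \<circ> chart_inv c) (g d) z) \<and>
     (\<forall>c\<in>\<A>. \<forall>z\<in>snd c ` fst c. \<forall>i j k.
        del k (\<lambda>w. g c w $ i $ j) z = del i (\<lambda>w. g c w $ k $ j) z)"

section \<open>Hermitian holomorphic line bundles\<close>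

text \<open>A local trivialisation is a pair \<open>(W, \<zeta>)\<close> of an open set \<open>W\<close> of the base and a linear fibre
  coordinate \<open>\<zeta>\<close> defined on the preimage of \<open>W\<close>.  The function \<open>normsq\<close> is the squared norm of the
  Hermitian structure, as a function on the total space.\<close>

record ('a, 'b, 'm) line_bundle_data =
  base :: "'a topology"
  atlas :: "('a set \<times> ('a \<Rightarrow> complex^'m::finite)) set"
  metric :: "'a set \<times> ('a \<Rightarrow> complex^'m) \<Rightarrow> complex^'m \<Rightarrow> complex^'m^'m"
  total :: "'b topology"
  proj :: "'b \<Rightarrow> 'a"
  trivs :: "('a set \<times> ('b \<Rightarrow> complex)) set"
  normsq :: "'b \<Rightarrow> real"

definition bundle_over :: "('a, 'b, 'm::finite) line_bundle_data \<Rightarrow> 'a set \<Rightarrow> 'b set" where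
  "bundle_over D W = {y \<in> topspace (total D). proj D y \<in> W}"

definition holomorphic_line_bundle :: "('a, 'b, 'm::finite) line_bundle_data \<Rightarrow> bool" where
  "holomorphic_line_bundle D \<longleftrightarrow>
     continuous_map (total D) (base D) (proj D) \<and>
     (\<Union>e\<in>trivs D. fst e) = topspace (base D) \<and>
     (\<forall>e\<in>trivs D. openin (base D) (fst e) \<and>
        homeomorphic_map (subtopology (total D) (bundle_over D (fst e)))
          (prod_topology (subtopology (base D) (fst e)) euclidean)
          (\<lambda>y. (proj D y, snd e y))) \<and>
     (\<forall>e\<in>trivs D. \<forall>e'\<in>trivs D. \<exists>k.
        (\<forall>y\<in>bundle_over D (fst e \<inter> fst e'). snd e' y = k (proj D y) * snd e y) \<and>
        (\<forall>x\<in>fst e \<inter> fst e'. k x \<noteq> 0) \<and>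
        (\<forall>c\<in>atlas D. holomorphic_fun_on (snd c ` (fst c \<inter> fst e \<inter> fst e')) (k \<circ> chart_inv c)))"

text \<open>The local function \<open>h\<close>: the squared norm of the unit section \<open>\<zeta> = 1\<close>.\<close>

definition local_norm :: "('a, 'b, 'm::finite) line_bundle_data \<Rightarrow> 'a set \<times> ('b \<Rightarrow> complex)
    \<Rightarrow> 'a \<Rightarrow> real" where
  "local_norm D e x =
     normsq D (inv_into (bundle_over D (fst e)) (\<lambda>y. (proj D y, snd e y)) (x, 1))"

definition hermitian_structure :: "('a, 'b, 'm::finite) line_bundle_data \<Rightarrow> bool" where
  "hermitian_structure D \<longleftrightarrow> (\<forall>e\<in>trivs D.
     (\<forall>y\<in>bundle_over D (fst e). normsq D y = (cmod (snd e y))\<^sup>2 * local_norm D e (proj D y)) \<and>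
     (\<forall>x\<in>fst e. 0 < local_norm D e x) \<and>
     (\<forall>c\<in>atlas D. smooth_on (snd c ` (fst c \<inter> fst e)) (local_norm D e \<circ> chart_inv c)))"

text \<open>Local expressions below depend on a chart \<open>c\<close> of the base and a trivialisation \<open>e\<close>, and live
  on the image in \<open>c\<close> of the common domain of \<open>c\<close> and \<open>e\<close>.\<close>

definition patch :: "'a set \<times> ('a \<Rightarrow> complex^'m) \<Rightarrow> 'a set \<times> ('b \<Rightarrow> complex) \<Rightarrow> (complex^'m) set" where
  "patch c e = snd c ` (fst c \<inter> fst e)"

definition curvature_form :: "('a, 'b, 'm::finite) line_bundle_data \<Rightarrow> ('a, 'm) chart
    \<Rightarrow> 'a set \<times> ('b \<Rightarrow> complex) \<Rightarrow> complex^'m \<Rightarrow> complex^'m^'m" where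
  "curvature_form D c e z = - i_ddbar (\<lambda>w. complex_of_real (ln (local_norm D e (chart_inv c w)))) z"

text \<open>The components of \<open>\<omega>\<^sub>M(\<tau>)\<close>, equivalently of \<open>g\<^sub>M(\<tau>)\<close>.\<close>

definition base_metric :: "('a, 'b, 'm::finite) line_bundle_data \<Rightarrow> real \<Rightarrow> ('a, 'm) chart
    \<Rightarrow> 'a set \<times> ('b \<Rightarrow> complex) \<Rightarrow> complex^'m \<Rightarrow> complex^'m^'m" where
  "base_metric D \<tau> c e z = metric D c z - \<tau> *\<^sub>R curvature_form D c e z"

text \<open>The quotient of top exterior powers \<open>\<omega>\<^sub>M(\<tau>)\<^sup>m / \<omega>\<^sub>M\<^sup>m\<close>: in coordinates the \<open>m\<close>-th power of the
  form with component matrix \<open>a\<close> is \<open>m! det a\<close> times \<open>\<Prod>i. (\<i>/2) dz\<^sup>i \<and> dzbar\<^sup>i\<close>.\<close>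

definition volume_ratio :: "('a, 'b, 'm::finite) line_bundle_data \<Rightarrow> real \<Rightarrow> ('a, 'm) chart
    \<Rightarrow> 'a set \<times> ('b \<Rightarrow> complex) \<Rightarrow> complex^'m \<Rightarrow> complex" where
  "volume_ratio D \<tau> c e z = det (base_metric D \<tau> c e z) / det (metric D c z)"

definition horizontal_data :: "('a, 'b, 'm::finite) line_bundle_data \<Rightarrow> real set \<Rightarrow> bool" where
  "horizontal_data D I \<longleftrightarrow>
     complex_manifold (base D) (atlas D) \<and> kaehler_metric (atlas D) (metric D) \<and>
     holomorphic_line_bundle D \<and> hermitian_structure D \<and> is_interval I \<and>
     (\<forall>\<tau>\<in>I. \<forall>c\<in>atlas D. \<forall>e\<in>trivs D. \<forall>z\<in>patch c e. positive_herm (base_metric D \<tau> c e z))"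

definition sigma_constant :: "('a, 'b, 'm::finite) line_bundle_data \<Rightarrow> real set \<Rightarrow> bool" where
  "sigma_constant D I \<longleftrightarrow>
     (\<exists>E. \<forall>c\<in>atlas D. \<forall>e\<in>trivs D. \<forall>z\<in>patch c e.
        eigenvalues (form_endo (metric D c z) (curvature_form D c e z)) = E) \<and>
     (\<forall>\<tau>\<in>I. \<exists>s. \<forall>c\<in>atlas D. \<forall>e\<in>trivs D. \<forall>z\<in>patch c e.
        scalar_curvature (base_metric D \<tau> c e) z = s)"

section \<open>The momentum construction\<close>

text \<open>On a closed set, smoothness up to the boundary is expressed by one-sided derivatives.\<close>

definition momentum_profile :: "real set \<Rightarrow> (real \<Rightarrow> real) \<Rightarrow> bool" where
  "momentum_profile I \<phi> \<longleftrightarrow>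
     (\<exists>d. d 0 = \<phi> \<and>
        (\<forall>k. \<forall>x\<in>closure I. (d k has_real_derivative d (Suc k) x) (at x within closure I))) \<and>
     (\<forall>x\<in>interior I. 0 < \<phi> x)"

definition profile_time :: "(real \<Rightarrow> real) \<Rightarrow> real \<Rightarrow> ereal \<Rightarrow> real" where
  "profile_time \<phi> \<tau>\<^sub>0 \<tau> = (LBINT x=ereal \<tau>\<^sub>0..\<tau>. 1 / \<phi> x)"

text \<open>The endpoints of the interior of \<open>I\<close> and the limits there of the integral may be infinite.\<close>

definition time_lower :: "real set \<Rightarrow> (real \<Rightarrow> real) \<Rightarrow> real \<Rightarrow> ereal" where
  "time_lower I \<phi> \<tau>\<^sub>0 =
     Lim (at_right (Inf (ereal ` interior I))) (\<lambda>\<tau>. ereal (profile_time \<phi> \<tau>\<^sub>0 \<tau>))"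

definition time_upper :: "real set \<Rightarrow> (real \<Rightarrow> real) \<Rightarrow> real \<Rightarrow> ereal" where
  "time_upper I \<phi> \<tau>\<^sub>0 =
     Lim (at_left (Sup (ereal ` interior I))) (\<lambda>\<tau>. ereal (profile_time \<phi> \<tau>\<^sub>0 \<tau>))"

definition momentum :: "real set \<Rightarrow> (real \<Rightarrow> real) \<Rightarrow> real \<Rightarrow> real \<Rightarrow> real" where
  "momentum I \<phi> \<tau>\<^sub>0 t = (THE \<tau>. \<tau> \<in> interior I \<and> t = profile_time \<phi> \<tau>\<^sub>0 (ereal \<tau>))"

definition potential :: "real set \<Rightarrow> (real \<Rightarrow> real) \<Rightarrow> real \<Rightarrow> real \<Rightarrow> real" where
  "potential I \<phi> \<tau>\<^sub>0 t = (LBINT x=ereal \<tau>\<^sub>0..ereal (momentum I \<phi> \<tau>\<^sub>0 t). x / \<phi> x)"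

definition log_norm :: "('a, 'b, 'm::finite) line_bundle_data \<Rightarrow> 'b \<Rightarrow> real" where
  "log_norm D y = ln (normsq D y) / 2"

text \<open>The domain \<open>t\<^sub>1 < t < t\<^sub>2\<close> in the complement of the zero section.\<close>

definition momentum_domain :: "('a, 'b, 'm::finite) line_bundle_data \<Rightarrow> real set \<Rightarrow> (real \<Rightarrow> real)
    \<Rightarrow> real \<Rightarrow> 'b set" where
  "momentum_domain D I \<phi> \<tau>\<^sub>0 =
     {y \<in> topspace (total D). normsq D y \<noteq> 0 \<and>
        time_lower I \<phi> \<tau>\<^sub>0 < ereal (log_norm D y) \<and> ereal (log_norm D y) < time_upper I \<phi> \<tau>\<^sub>0}"

text \<open>The charts of the total space: \<open>None\<close> is the index of the fibre coordinate, and \<open>Some i\<close>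
  those of the coordinates pulled back from the base.\<close>

definition bundle_chart :: "('a, 'b, 'm::finite) line_bundle_data \<Rightarrow> ('a, 'm) chart
    \<Rightarrow> 'a set \<times> ('b \<Rightarrow> complex) \<Rightarrow> ('b, 'm option) chart" where
  "bundle_chart D c e =
     (bundle_over D (fst c \<inter> fst e),
      \<lambda>y. \<chi> k. case k of None \<Rightarrow> snd e y | Some i \<Rightarrow> snd c (proj D y) $ i)"

text \<open>The components of \<open>\<omega>\<^sub>\<phi> = p\<^sup>*\<omega>\<^sub>M + 2 \<i> \<partial>\<partial>bar f(t)\<close> in such a chart.\<close>

definition bundle_metric :: "('a, 'b, 'm::finite) line_bundle_data \<Rightarrow> real set \<Rightarrow> (real \<Rightarrow> real)
    \<Rightarrow> real \<Rightarrow> ('a, 'm) chart \<Rightarrow> 'a set \<times> ('b \<Rightarrow> complex)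
    \<Rightarrow> complex^('m option) \<Rightarrow> complex^('m option)^('m option)" where
  "bundle_metric D I \<phi> \<tau>\<^sub>0 c e w =
     pullback (snd c \<circ> proj D \<circ> chart_inv (bundle_chart D c e)) (metric D c) w +
     2 *\<^sub>R i_ddbar (\<lambda>v. complex_of_real
              (potential I \<phi> \<tau>\<^sub>0 (log_norm D (chart_inv (bundle_chart D c e) v)))) w"

end

theory Submission
  imports Defs
begin

no_notation fps_nth (infixl "$" 75)

text \<open>In a bundle chart put \<open>t = (log |z\<^sup>0|\<^sup>2 + log h) / 2\<close>.  Since \<open>f' = \<mu>\<close> and \<open>\<mu>' = \<phi>(\<mu>)\<close>, the chain rule
  gives \<open>g\<^sub>\<phi> = N diag(4\<phi>, g\<^sub>M(\<tau>)) N\<^sup>*\<close>, where the columns of \<open>N\<close> are \<open>\<partial>t\<close> and the base directions.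
  Hence \<open>det g\<^sub>\<phi> = Q\<phi>(\<tau>) det g\<^sub>M / |z\<^sup>0|\<^sup>2\<close>, and with \<open>u(t) = log (Q\<phi>)(\<mu>(t))\<close> the Ricci form is
  \<open>N diag(-2u'', \<rho>\<^sub>M + u'\<gamma>/2) N\<^sup>*\<close>.  So \<open>\<sigma>\<^sub>\<phi> = \<sigma>\<^sub>M(\<tau>) + u' tr(g\<^sub>M(\<tau>)\<inverse>\<gamma>)/2 - u''/(2\<phi>)\<close>, and Jacobi's
  formula \<open>tr(g\<^sub>M(\<tau>)\<inverse>\<gamma>) = -Q'/Q\<close> turns this into the claim.  That formula also exhibits
  \<open>P = 2Q\<sigma>\<^sub>M\<close> as a polynomial: it is the derivative at \<open>s = 0\<close> of \<open>2 det(g\<^sub>M(\<tau>) + s\<rho>\<^sub>M) / det g\<^sub>M\<close>.\<close>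

section \<open>Matrices indexed by an option type\<close>

text \<open>Everything rests on \<open>Q\<close> not depending on the point. The quotient of
  determinants is \<open>det (1 - \<tau> B)\<close>, a reversed characteristic polynomial, so
  constant eigenvalues make it a polynomial in \<tau> alone. Hence all
  \<open>g\<^sub>M(\<tau>)\<close> with \<tau> fixed share one Ricci form. On the total space, where
  \<tau> varies from point to point, \<open>log det g\<^sub>\<phi>\<close> still splits into a
  function of \<open>t\<close>, a pullback from the base and the pluriharmonic
  \<open>-log |z\<^sup>0|\<^sup>2\<close>.

  The constants come from the normalisation of components:
  \<open>\<i> \<partial>\<partial>bar F(t)\<close> has the components \<open>-F' \<gamma>/2\<close>
  plus \<open>2 F''\<close> times the product of \<open>\<partial>t\<close> with its conjugate.
  Taking \<open>F = 2f\<close> gives \<open>-\<tau>\<gamma>\<close> and \<open>4\<phi>\<close>,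
  taking \<open>F = -u\<close> gives the Ricci form.

  A second concern is reality: \<open>Q\<close> and \<open>P\<close> are real, the matrices are
  complex, and the Ricci form is defined through the logarithm of a real part. This is what the
  Hermitian symmetry of \<open>\<i> \<partial>\<partial>bar\<close>, with the symmetry of second
  derivatives behind it, and the positivity of determinants are for.\<close>

lemma sum_UNIV_option:
  "(\<Sum>k\<in>(UNIV :: 'm::finite option set). f k) = f None + (\<Sum>a\<in>UNIV. f (Some a))"
  by (simp add: UNIV_option_conv sum.reindex)

lemma prod_UNIV_option:
  "(\<Prod>k\<in>(UNIV :: 'm::finite option set). f k) = f None * (\<Prod>a\<in>UNIV. f (Some a))"
  by (simp add: UNIV_option_conv prod.reindex)

definition block :: "'a::zero \<Rightarrow> 'a^'m^'m \<Rightarrow> 'a^('m option)^('m option)" where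
  "block x A = (\<chi> i j. case i of
      None \<Rightarrow> (case j of None \<Rightarrow> x | Some _ \<Rightarrow> 0)
    | Some a \<Rightarrow> (case j of None \<Rightarrow> 0 | Some b \<Rightarrow> A $ a $ b))"

lemma block_nth [simp]:
  fixes A :: "'a::zero^'m::finite^'m"
  shows "block x A $ None $ None = x" "block x A $ None $ Some b = 0"
    "block x A $ Some a $ None = 0" "block x A $ Some a $ Some b = A $ a $ b"
  by (simp_all add: block_def)

lemma matrix_option_eqI:
  fixes A B :: "'a^('m::finite option)^('m option)"
  assumes "A $ None $ None = B $ None $ None" "\<And>b. A $ None $ Some b = B $ None $ Some b"
    "\<And>a. A $ Some a $ None = B $ Some a $ None" "\<And>a b. A $ Some a $ Some b = B $ Some a $ Some b"
  shows "A = B"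
  unfolding vec_eq_iff using assms by (metis option.exhaust)

lemma block_mult:
  fixes A B :: "'a::semiring_1^'m::finite^'m"
  shows "block x A ** block y B = block (x * y) (A ** B)"
  by (rule matrix_option_eqI) (simp_all add: matrix_matrix_mult_def sum_UNIV_option)

lemma block_mat_1: "block 1 (mat 1 :: 'a::semiring_1^'m::finite^'m) = mat 1"
  by (rule matrix_option_eqI) (simp_all add: mat_def)

lemma trace_block:
  fixes A :: "'a::comm_semiring_1^'m::finite^'m"
  shows "trace (block x A) = x + trace A"
  by (simp add: trace_def sum_UNIV_option)

text \<open>A permutation that moves \<open>None\<close> picks up a zero of the first row, so only
  the permutations supported on \<open>range Some\<close> survive in the Leibniz sum.\<close>

lemma det_first_row:
  fixes A :: "'a::comm_ring_1^('m::finite option)^('m option)"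
  assumes "\<And>j. A $ None $ Some j = 0"
  shows "det A = A $ None $ None * det (\<chi> i j. A $ Some i $ Some j)"
proof -
  let ?S = "range (Some :: 'm \<Rightarrow> 'm option)"
  have inj: "inj_on (Some :: 'm \<Rightarrow> 'm option) UNIV" by simp
  have bij: "bij_betw (Some :: 'm \<Rightarrow> 'm option) UNIV ?S" by (simp add: bij_betw_def)
  have bij': "bij_betw the ?S (UNIV :: 'm set)"
    by (auto simp: bij_betw_def inj_on_def image_def)
  have "det A = (\<Sum>p | p permutes UNIV. of_int (sign p) * (\<Prod>i\<in>UNIV. A $ i $ p i))"
    by (simp add: det_def)
  also have "\<dots> = (\<Sum>p | p permutes ?S. of_int (sign p) * (\<Prod>i\<in>UNIV. A $ i $ p i))"
  proof (rule sum.mono_neutral_right)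
    show "finite {p. p permutes (UNIV :: 'm option set)}" by (simp add: finite_permutations)
    show "{p. p permutes ?S} \<subseteq> {p. p permutes UNIV}" by (auto intro: permutes_subset)
    show "\<forall>p\<in>{p. p permutes UNIV} - {p. p permutes ?S}. of_int (sign p) * (\<Prod>i\<in>UNIV. A $ i $ p i) = 0"
    proof
      fix p :: "'m option \<Rightarrow> 'm option"
      assume p: "p \<in> {p. p permutes UNIV} - {p. p permutes ?S}"
      have "p None \<noteq> None"
      proof
        assume "p None = None"
        then have "\<And>x. x \<notin> ?S \<Longrightarrow> p x = x" by (metis option.exhaust rangeI)
        then have "p permutes ?S" using p permutes_superset[of p UNIV ?S] by auto
        then show False using p by simp
      qed
      then obtain j where "p None = Some j" by auto
      then have "A $ None $ p None = 0" using assms by simp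
      then show "of_int (sign p) * (\<Prod>i\<in>UNIV. A $ i $ p i) = 0"
        by (simp add: prod_UNIV_option)
    qed
  qed
  also have "\<dots> = (\<Sum>q | q permutes (UNIV :: 'm set).
      A $ None $ None * (of_int (sign q) * (\<Prod>i\<in>UNIV. A $ Some i $ Some (q i))))"
  \<comment> \<open>Transport along \<open>Some\<close> and its inverse \<open>the\<close> matches
    these permutations with those of the smaller index type and preserves signs.\<close>
  proof (rule sum.reindex_bij_witness[where i = "map_permutation UNIV Some"
        and j = "map_permutation ?S the"])
    fix p assume p: "p \<in> {p. p permutes ?S}"
    show "map_permutation UNIV Some (map_permutation ?S the p) = p"
      using p by (intro map_permutation_compose_inv[OF bij']) auto
    show "map_permutation ?S the p \<in> {q. q permutes UNIV}"
      using p map_permutation_permutes[OF bij'] by auto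
    have 1: "sign (map_permutation ?S the p) = sign p"
      using p bij' by (intro sign_map_permutation) (auto simp: bij_betw_def)
    have 2: "Some (map_permutation ?S the p i) = p (Some i)" for i
    proof -
      have "map_permutation ?S the p (the (Some i)) = the (p (Some i))"
        using bij' by (intro map_permutation_apply) (auto simp: bij_betw_def)
      moreover have "p (Some i) \<in> ?S" using p permutes_in_image by fastforce
      ultimately show ?thesis by auto
    qed
    have 3: "p None = None" using p by (auto simp: permutes_def)
    show "A $ None $ None * (of_int (sign (map_permutation ?S the p)) *
          (\<Prod>i\<in>UNIV. A $ Some i $ Some (map_permutation ?S the p i))) =
        of_int (sign p) * (\<Prod>i\<in>UNIV. A $ i $ p i)"
      unfolding 1 2 by (simp add: prod_UNIV_option 3 mult_ac)
  next
    fix q assume q: "q \<in> {q. q permutes (UNIV :: 'm set)}"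
    show "map_permutation ?S the (map_permutation UNIV Some q) = q"
      using q by (intro map_permutation_compose_inv[OF bij]) auto
    show "map_permutation UNIV Some q \<in> {p. p permutes ?S}"
      using q map_permutation_permutes[OF bij] by auto
  qed
  also have "\<dots> = A $ None $ None * det (\<chi> i j. A $ Some i $ Some j)"
    by (simp add: det_def sum_distrib_left)
  finally show ?thesis .
qed

lemma det_block:
  fixes A :: "'a::comm_ring_1^'m::finite^'m"
  shows "det (block x A) = x * det A"
proof -
  have "(\<chi> i j. A $ i $ j) = A" by (simp add: vec_eq_iff)
  then show ?thesis using det_first_row[of "block x A"] by simp
qed

section \<open>Distributivity, inverses and transposes of matrices\<close>

lemma matrix_add_rdistrib:
  fixes A B :: "'a::semiring_1^'n^'m"
  shows "(A + B) ** C = A ** C + B ** C"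
  by (simp add: vec_eq_iff matrix_matrix_mult_def distrib_right sum.distrib)

lemma matrix_diff_rdistrib:
  fixes A B :: "'a::ring_1^'n^'m"
  shows "(A - B) ** C = A ** C - B ** C"
  by (simp add: vec_eq_iff matrix_matrix_mult_def left_diff_distrib sum_subtractf)

lemma matrix_inv_both:
  fixes A :: "'a::field^'n^'n"
  assumes "det A \<noteq> 0"
  shows "A ** matrix_inv A = mat 1" "matrix_inv A ** A = mat 1"
proof -
  have "\<exists>B. A ** B = mat 1 \<and> B ** A = mat 1"
    using assms invertible_det_nz[of A] by (auto simp: invertible_def)
  then have "A ** matrix_inv A = mat 1 \<and> matrix_inv A ** A = mat 1"
    unfolding matrix_inv_def by (rule someI_ex)
  then show "A ** matrix_inv A = mat 1" "matrix_inv A ** A = mat 1" by auto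
qed

lemma matrix_inv_eqI:
  fixes A :: "'a::field^'n^'n"
  assumes "A ** B = mat 1"
  shows "matrix_inv A = B"
proof -
  have "det A * det B = 1" using assms by (metis det_I det_mul)
  then have "matrix_inv A ** A = mat 1" by (intro matrix_inv_both) auto
  then show ?thesis using assms by (metis matrix_mul_assoc matrix_mul_lid matrix_mul_rid)
qed

lemma trace_transpose: "trace (transpose A) = trace A"
  by (simp add: trace_def transpose_def)

section \<open>Hermitian matrices\<close>

definition hermitian :: "complex^'n^'n \<Rightarrow> bool" where
  "hermitian a \<longleftrightarrow> (\<forall>i j. a $ i $ j = cnj (a $ j $ i))"

lemma hermitianD: "hermitian a \<Longrightarrow> cnj (a $ i $ j) = a $ j $ i"
  unfolding hermitian_def by (rule sym) blast

lemma hermitian_uminus: "hermitian a \<Longrightarrow> hermitian (- a)"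
  by (simp add: hermitian_def[of "- a"] hermitianD)

lemma hermitian_det_real:
  assumes "hermitian a"
  shows "Im (det a) = 0"
proof -
  have "cnj (det a) = det (transpose a)"
    by (simp add: det_def transpose_def hermitianD[OF assms])
  then show ?thesis by (simp add: complex_eq_iff)
qed

lemma positive_herm_hermitian: "positive_herm a \<Longrightarrow> hermitian a"
  unfolding positive_herm_def hermitian_def by blast

lemma positive_herm_det_nonzero:
  assumes "positive_herm a"
  shows "det a \<noteq> 0"
proof
  assume "det a = 0"
  then have "\<not> (\<exists>B. B ** a = mat 1)"
    using invertible_det_nz invertible_left_inverse by blast
  then obtain u where u: "a *v u = 0" "u \<noteq> 0"
    using matrix_left_invertible_ker by blast
  \<comment> \<open>The form in \<open>positive_herm\<close> conjugates its second argument, so a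
    kernel vector has to enter it through its conjugate.\<close>
  define v where "v = (\<chi> i. cnj (u $ i))"
  have "v \<noteq> 0" using u(2) by (auto simp: v_def vec_eq_iff)
  have "(\<Sum>i\<in>UNIV. \<Sum>j\<in>UNIV. v $ i * a $ i $ j * cnj (v $ j)) = (\<Sum>i\<in>UNIV. v $ i * (a *v u) $ i)"
    by (simp add: v_def matrix_vector_mult_def sum_distrib_left mult.assoc)
  moreover have "0 < Re (\<Sum>i\<in>UNIV. \<Sum>j\<in>UNIV. v $ i * a $ i $ j * cnj (v $ j))"
    using assms \<open>v \<noteq> 0\<close> unfolding positive_herm_def by blast
  ultimately show False using u(1) by simp
qed

lemma positive_herm_mat_1: "positive_herm (mat 1)"
  unfolding positive_herm_def
proof (intro conjI allI impI)
  fix v :: "complex^'n" assume "v \<noteq> 0"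
  then obtain k where k: "v $ k \<noteq> 0" by (auto simp: vec_eq_iff)
  have "(\<Sum>j\<in>UNIV. v $ i * mat 1 $ i $ j * cnj (v $ j)) = of_real ((cmod (v $ i))\<^sup>2)" for i
  proof -
    have "(\<Sum>j\<in>UNIV. v $ i * mat 1 $ i $ j * cnj (v $ j)) = (\<Sum>j\<in>UNIV. if i = j then v $ i * cnj (v $ j) else 0)"
      by (intro sum.cong) (auto simp: mat_def)
    also have "\<dots> = of_real ((cmod (v $ i))\<^sup>2)"
      using complex_norm_square[of "v $ i"] by simp
    finally show ?thesis .
  qed
  then have "Re (\<Sum>i\<in>UNIV. \<Sum>j\<in>UNIV. v $ i * mat 1 $ i $ j * cnj (v $ j)) = (\<Sum>i\<in>UNIV. (cmod (v $ i))\<^sup>2)"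
    by (simp del: of_real_power)
  also have "\<dots> > 0" by (rule sum_pos2[of _ k]) (use k in auto)
  finally show "0 < Re (\<Sum>i\<in>UNIV. \<Sum>j\<in>UNIV. v $ i * mat 1 $ i $ j * cnj (v $ j))" .
qed (simp add: mat_def)

lemma positive_herm_convex:
  fixes a b :: "complex^'n^'n"
  assumes a: "positive_herm a" and b: "positive_herm b" and s: "0 \<le> s" "s \<le> 1"
  shows "positive_herm ((1 - s) *\<^sub>R a + s *\<^sub>R b)"
  unfolding positive_herm_def
proof (intro conjI allI impI)
  fix i j show "((1 - s) *\<^sub>R a + s *\<^sub>R b) $ i $ j = cnj (((1 - s) *\<^sub>R a + s *\<^sub>R b) $ j $ i)"
    by (simp add: hermitianD[OF positive_herm_hermitian[OF a]] hermitianD[OF positive_herm_hermitian[OF b]])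
next
  fix v :: "complex^'n" assume v: "v \<noteq> 0"
  let ?f = "\<lambda>c :: complex^'n^'n. Re (\<Sum>i\<in>UNIV. \<Sum>j\<in>UNIV. v $ i * c $ i $ j * cnj (v $ j))"
  have "?f ((1 - s) *\<^sub>R a + s *\<^sub>R b) = Re (\<Sum>i\<in>UNIV. \<Sum>j\<in>UNIV.
      (1 - s) *\<^sub>R (v $ i * a $ i $ j * cnj (v $ j)) + s *\<^sub>R (v $ i * b $ i $ j * cnj (v $ j)))"
    by (simp only: vector_add_component vector_scaleR_component distrib_left distrib_right
        mult_scaleR_left mult_scaleR_right)
  also have "\<dots> = (1 - s) * ?f a + s * ?f b"
    by (simp only: sum.distrib scaleR_sum_right[symmetric] plus_complex.sel scaleR_complex.sel)
  finally have "?f ((1 - s) *\<^sub>R a + s *\<^sub>R b) = (1 - s) * ?f a + s * ?f b" .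
  moreover have "0 < ?f a" "0 < ?f b" using a b v unfolding positive_herm_def by blast+
  moreover have "0 < (1 - s) * x + s * y" if "0 < x" "0 < y" for x y :: real
    using s that by (cases "s = 0") (auto intro: add_nonneg_pos)
  ultimately show "0 < ?f ((1 - s) *\<^sub>R a + s *\<^sub>R b)"
    by (simp only:)
qed

text \<open>The determinant does not vanish along the segment from the identity.\<close>

lemma positive_herm_det_pos:
  assumes a: "positive_herm a"
  shows "0 < Re (det a)"
proof (rule ccontr)
  assume neg: "\<not> 0 < Re (det a)"
  define A where "A s = (1 - s) *\<^sub>R mat 1 + s *\<^sub>R a" for s :: real
  have "continuous_on {0..1} (\<lambda>s. Re (det (A s)))"
    unfolding A_def det_def by (intro continuous_intros)
  moreover have "Re (det (A 0)) = 1" "Re (det (A 1)) \<le> 0" using neg by (auto simp: A_def)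
  ultimately obtain s where s: "0 \<le> s" "s \<le> 1" "Re (det (A s)) = 0"
    using IVT2'[of "\<lambda>s. Re (det (A s))" 1 0 0] by auto
  have "positive_herm (A s)"
    unfolding A_def by (intro positive_herm_convex positive_herm_mat_1 a s)
  then have "det (A s) \<noteq> 0" "Im (det (A s)) = 0"
    by (simp_all add: positive_herm_det_nonzero hermitian_det_real positive_herm_hermitian)
  then show False using s(3) by (simp add: complex_eq_iff)
qed

section \<open>Derivatives of determinants\<close>

text \<open>The differential of \<open>det\<close> at \<open>A\<close> in the direction
  \<open>Y\<close>. Being an explicit Leibniz sum, it also makes sense for matrices of polynomials,
  where no limit is at hand; \<open>curvature_poly\<close> depends on this.\<close>

definition det_derivative :: "'a::comm_ring_1^'n^'n \<Rightarrow> 'a^'n^'n \<Rightarrow> 'a" where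
  "det_derivative A Y = (\<Sum>p | p permutes UNIV.
     of_int (sign p) * (\<Sum>j\<in>UNIV. Y $ j $ p j * (\<Prod>i\<in>UNIV - {j}. A $ i $ p i)))"

lemma has_field_derivative_det:
  fixes A Y :: "'a::real_normed_field^'n^'n"
  shows "((\<lambda>s. det (\<chi> i j. A $ i $ j + s * Y $ i $ j)) has_field_derivative det_derivative A Y) (at 0)"
proof -
  have 1: "((\<lambda>s. \<Prod>i\<in>UNIV. A $ i $ p i + s * Y $ i $ p i) has_field_derivative
      (\<Sum>j\<in>UNIV. Y $ j $ p j * (\<Prod>i\<in>UNIV - {j}. A $ i $ p i + 0 * Y $ i $ p i))) (at 0)" for p
    by (rule has_field_derivative_prod) (auto intro!: derivative_eq_intros)
  show ?thesis
    unfolding det_def det_derivative_def using 1 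
    by (auto intro!: DERIV_sum DERIV_cmult)
qed

text \<open>A permutation other than the identity moves at least two points. After one index is
  removed from the product, an off-diagonal zero of the identity matrix remains.\<close>

lemma det_derivative_mat_1: "det_derivative (mat 1) X = trace X"
proof -
  have *: "(\<Sum>j\<in>UNIV. X $ j $ p j * (\<Prod>i\<in>UNIV - {j}. mat 1 $ i $ p i)) = 0"
    if p: "p permutes UNIV" "p \<noteq> id" for p
  proof (rule sum.neutral, rule ballI)
    fix j
    have "\<exists>i. i \<noteq> j \<and> p i \<noteq> i"
    proof (rule ccontr)
      assume "\<not> ?thesis"
      then have fixed: "p i = i" if "i \<noteq> j" for i using that by blast
      moreover have "p j = j" using fixed permutes_inj[OF p(1)] by (metis injD)
      ultimately have "p x = x" for x by (cases "x = j") auto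
      then show False using p(2) by auto
    qed
    then obtain i where "i \<noteq> j" "p i \<noteq> i" by auto
    then have "(\<Prod>i\<in>UNIV - {j}. mat 1 $ i $ p i) = (0 :: 'a)"
      by (intro prod_zero) (auto simp: mat_def intro!: bexI[of _ i])
    then show "X $ j $ p j * (\<Prod>i\<in>UNIV - {j}. mat 1 $ i $ p i) = 0" by simp
  qed
  have "det_derivative (mat 1) X = (\<Sum>p\<in>{id}.
     of_int (sign p) * (\<Sum>j\<in>UNIV. X $ j $ p j * (\<Prod>i\<in>UNIV - {j}. mat 1 $ i $ p i)))"
    unfolding det_derivative_def
    by (rule sum.mono_neutral_right) (auto simp: finite_permutations permutes_id *)
  also have "\<dots> = trace X" by (simp add: trace_def mat_def)
  finally show ?thesis .
qed

text \<open>Jacobi's formula. The factorisation \<open>A + s Y = (1 + s Y A\<inverse>) A\<close>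
  reduces it to the identity matrix, and uniqueness of derivatives compares the two results.\<close>

lemma det_derivative_eq_trace:
  fixes A Y :: "'a::real_normed_field^'n^'n"
  assumes "det A \<noteq> 0"
  shows "det_derivative A Y = det A * trace (Y ** matrix_inv A)"
proof -
  let ?X = "Y ** matrix_inv A"
  have eq: "(\<chi> i j. A $ i $ j + s * Y $ i $ j) = (\<chi> i j. mat 1 $ i $ j + s * ?X $ i $ j) ** A" for s
  proof -
    have "(\<chi> i j. mat 1 $ i $ j + s * ?X $ i $ j) = mat 1 + mat s ** ?X"
      by (simp add: vec_eq_iff matrix_matrix_mult_def mat_def if_distrib[of "\<lambda>x. x * _"] cong: if_cong)
    then have "(\<chi> i j. mat 1 $ i $ j + s * ?X $ i $ j) ** A = A + mat s ** (Y ** (matrix_inv A ** A))"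
      by (simp add: matrix_add_rdistrib matrix_mul_assoc)
    also have "\<dots> = A + mat s ** Y" by (simp add: matrix_inv_both[OF assms])
    finally show ?thesis
      by (simp add: vec_eq_iff matrix_matrix_mult_def mat_def if_distrib[of "\<lambda>x. x * _"] cong: if_cong)
  qed
  have "((\<lambda>s. det (\<chi> i j. A $ i $ j + s * Y $ i $ j)) has_field_derivative trace ?X * det A) (at 0)"
    unfolding eq det_mul
    using DERIV_cmult_right[OF has_field_derivative_det[of "mat 1" ?X], of "det A"]
    by (simp add: det_derivative_mat_1)
  from DERIV_unique[OF has_field_derivative_det[of A Y] this] show ?thesis
    by (simp only: mult.commute)
qed

lemma poly_det: "poly (det M) x = det (\<chi> i j. poly (M $ i $ j) x)"
  by (simp add: det_def poly_sum poly_prod)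

lemma poly_det_derivative:
  "poly (det_derivative M N) x = det_derivative (\<chi> i j. poly (M $ i $ j) x) (\<chi> i j. poly (N $ i $ j) x)"
  by (simp add: det_derivative_def poly_sum poly_prod)

text \<open>For real \<open>s\<close> the matrix \<open>A + s Y\<close> stays Hermitian, so the
  imaginary part of its determinant is constantly zero along the real line.\<close>

lemma hermitian_det_derivative_real:
  assumes "hermitian A" "hermitian Y"
  shows "Im (det_derivative A Y) = 0"
proof -
  let ?f = "\<lambda>s :: real. det (\<chi> i j. A $ i $ j + of_real s * Y $ i $ j)"
  have "(?f has_vector_derivative det_derivative A Y) (at 0)"
    using has_field_derivative_det[of A Y] by (intro has_vector_derivative_real_field) simp
  then have "((\<lambda>s. Im (?f s)) has_vector_derivative Im (det_derivative A Y)) (at 0)"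
    by (rule bounded_linear.has_vector_derivative[OF bounded_linear_Im])
  moreover have "Im (?f s) = 0" for s
    by (rule hermitian_det_real) (simp add: hermitian_def hermitianD[OF assms(1)] hermitianD[OF assms(2)])
  ultimately show ?thesis
    using vector_derivative_unique_at[of "\<lambda>s. Im (?f s)" _ 0 0] by simp
qed

section \<open>The characteristic polynomial\<close>

lemma poly_charpoly: "poly (charpoly A) x = det (mat x - A)"
  unfolding charpoly_def poly_det
  by (intro arg_cong[where f = det]) (simp add: vec_eq_iff mat_def)

lemma det_scale:
  fixes A :: "'a::comm_ring_1^'n^'n"
  shows "det (\<chi> i j. s * A $ i $ j) = s ^ CARD('n) * det A"
  by (simp add: det_def prod.distrib sum_distrib_left mult_ac)

lemma tendsto_det_mat_1_minus:
  fixes A :: "complex^'n^'n"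
  shows "((\<lambda>s. det (\<chi> i j. mat 1 $ i $ j - s * A $ i $ j)) \<longlongrightarrow> 1) (at 0)"
proof -
  have "isCont (\<lambda>s. det (\<chi> i j. mat 1 $ i $ j - s * A $ i $ j)) 0"
    unfolding det_def by (auto intro!: continuous_intros)
  moreover have "(\<chi> i j. mat 1 $ i $ j - 0 * A $ i $ j) = (mat 1 :: complex^'n^'n)"
    by (simp add: vec_eq_iff)
  ultimately show ?thesis by (simp add: isCont_def del: mult_zero_left)
qed

text \<open>Reversal of the characteristic polynomial, from \<open>1 - s A = s (1/s - A)\<close>. It
  serves to compare leading coefficients as \<open>s\<close> tends to 0, and with
  \<open>s = \<tau>\<close> to recognise \<open>Q\<close>.\<close>

lemma det_mat_1_minus_eq:
  fixes A :: "complex^'n^'n"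
  assumes "s \<noteq> 0"
  shows "det (\<chi> i j. mat 1 $ i $ j - s * A $ i $ j) = s ^ CARD('n) * poly (charpoly A) (1 / s)"
  unfolding poly_charpoly det_scale[symmetric]
  by (intro arg_cong[where f = det]) (use assms in \<open>simp add: vec_eq_iff mat_def algebra_simps\<close>)

text \<open>Otherwise \<open>det (1 - s A)\<close> would vanish for all \<open>s \<noteq> 0\<close>
  and could not tend to 1. A polynomial is recovered from its roots and leading coefficient, and
  dividing by the latter requires it to be nonzero.\<close>

lemma charpoly_nonzero: "charpoly A \<noteq> 0"
proof
  assume "charpoly A = 0"
  then have "eventually (\<lambda>s. det (\<chi> i j. mat 1 $ i $ j - s * A $ i $ j) = 0) (at 0)"
    by (auto simp: det_mat_1_minus_eq eventually_at_filter)
  then have "((\<lambda>s. 0) \<longlongrightarrow> (1::complex)) (at (0 :: complex))"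
    using tendsto_det_mat_1_minus[of A] by (rule Lim_transform_eventually[rotated])
  then show False by (simp add: tendsto_const_iff)
qed

text \<open>Both characteristic polynomials are monic, which is expressed by the limit of
  \<open>det (1 - s A)\<close> at \<open>s = 0\<close>.\<close>

lemma charpoly_eqI:
  fixes A B :: "complex^'n^'n"
  assumes "eigenvalues A = eigenvalues B"
  shows "charpoly A = charpoly B"
proof -
  define c where "c = lead_coeff (charpoly A) / lead_coeff (charpoly B)"
  have c: "charpoly A = smult c (charpoly B)"
    using complex_poly_decompose_multiset[of "charpoly A"] complex_poly_decompose_multiset[of "charpoly B"]
      charpoly_nonzero[of B] assms
    unfolding eigenvalues_def c_def
    by (metis leading_coeff_0_iff nonzero_eq_divide_eq smult_smult)
  have "((\<lambda>s. c * det (\<chi> i j. mat 1 $ i $ j - s * B $ i $ j)) \<longlongrightarrow> c * 1) (at 0)"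
    by (intro tendsto_intros tendsto_det_mat_1_minus)
  moreover have "eventually (\<lambda>s. c * det (\<chi> i j. mat 1 $ i $ j - s * B $ i $ j) =
      det (\<chi> i j. mat 1 $ i $ j - s * A $ i $ j)) (at 0)"
    by (simp add: eventually_at_filter det_mat_1_minus_eq c)
  ultimately have "((\<lambda>s. det (\<chi> i j. mat 1 $ i $ j - s * A $ i $ j)) \<longlongrightarrow> c * 1) (at 0)"
    by (rule Lim_transform_eventually)
  then have "c = 1" using tendsto_det_mat_1_minus[of A] tendsto_unique[of "at (0::complex)"] by force
  then show ?thesis using c by simp
qed

text \<open>Factoring \<open>g\<close> out on the right leaves
  \<open>1 - \<tau> \<gamma> g\<inverse>\<close>, whose transpose is \<open>1 - \<tau> B\<close>.
  The right-hand side involves the point only through the eigenvalues of \<open>B\<close>, which is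
  how constant eigenvalues yield a constant \<open>Q\<close>.\<close>

lemma det_ratio_eq:
  fixes g \<gamma> :: "complex^'n^'n"
  assumes g: "det g \<noteq> 0" and \<tau>: "\<tau> \<noteq> 0"
  shows "det (g - \<tau> *\<^sub>R \<gamma>) / det g =
    of_real \<tau> ^ CARD('n) * poly (charpoly (form_endo g \<gamma>)) (1 / of_real \<tau>)"
proof -
  let ?X = "\<gamma> ** matrix_inv g"
  have "(mat 1 - \<tau> *\<^sub>R ?X) ** g = g - \<tau> *\<^sub>R (\<gamma> ** (matrix_inv g ** g))"
    by (simp add: matrix_diff_rdistrib scalar_matrix_assoc matrix_mul_assoc)
  then have "g - \<tau> *\<^sub>R \<gamma> = (mat 1 - \<tau> *\<^sub>R ?X) ** g" by (simp add: matrix_inv_both[OF g])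
  then have "det (g - \<tau> *\<^sub>R \<gamma>) / det g = det (transpose (mat 1 - \<tau> *\<^sub>R ?X))"
    using g by (simp add: det_mul)
  also have "transpose (mat 1 - \<tau> *\<^sub>R ?X) = (\<chi> i j. mat 1 $ i $ j - of_real \<tau> * form_endo g \<gamma> $ i $ j)"
    by (simp add: vec_eq_iff transpose_def form_endo_def mat_def scaleR_conv_of_real[where 'a = complex])
  finally show ?thesis using \<tau> by (simp add: det_mat_1_minus_eq)
qed

section \<open>Twice differentiable functions\<close>

text \<open>Second derivatives have to exist but need not be continuous. This is all that the Ricci
  form and the symmetry of mixed derivatives use, and it is easily passed through sums, products,
  determinants and compositions.\<close>

definition c2_on :: "'v::real_normed_vector set \<Rightarrow> ('v \<Rightarrow> 'w::real_normed_vector) \<Rightarrow> bool" where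
  "c2_on S f \<longleftrightarrow> (\<forall>x\<in>S. f differentiable (at x)) \<and>
     (\<forall>v. \<forall>x\<in>S. (\<lambda>y. frechet_derivative f (at y) v) differentiable (at x))"

lemma smooth_on_imp_c2_on:
  assumes "smooth_on S f"
  shows "c2_on S f"
proof -
  have "ck_on (Suc (Suc 0)) S f" using assms unfolding smooth_on_def by blast
  then show ?thesis by (simp add: c2_on_def)
qed

lemma differentiable_transform_open:
  assumes "f differentiable (at x)" "open S" "x \<in> S" "\<And>y. y \<in> S \<Longrightarrow> f y = g y"
  shows "g differentiable (at x)"
  using assms has_derivative_transform_within_open unfolding differentiable_def by metis

lemma c2_onI:
  assumes "open S" "\<And>x. x \<in> S \<Longrightarrow> (f has_derivative f' x) (at x)"
    "\<And>v x. x \<in> S \<Longrightarrow> (\<lambda>y. f' y v) differentiable (at x)"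
  shows "c2_on S f"
  unfolding c2_on_def
proof (intro conjI ballI allI)
  fix x assume "x \<in> S" then show "f differentiable (at x)" using assms(2) by (auto simp: differentiable_def)
next
  fix v x assume x: "x \<in> S"
  show "(\<lambda>y. frechet_derivative f (at y) v) differentiable (at x)"
    by (rule differentiable_transform_open[OF assms(3)[OF x, of v] assms(1) x])
      (metis assms(2) frechet_derivative_at)
qed

lemma c2_on_has_derivative:
  "c2_on S f \<Longrightarrow> x \<in> S \<Longrightarrow> (f has_derivative frechet_derivative f (at x)) (at x)"
  unfolding c2_on_def using frechet_derivative_works by blast

lemma c2_on_differentiable: "c2_on S f \<Longrightarrow> x \<in> S \<Longrightarrow> f differentiable (at x)"
  unfolding c2_on_def by blast

lemma c2_on_differentiable2:
  "c2_on S f \<Longrightarrow> x \<in> S \<Longrightarrow> (\<lambda>y. frechet_derivative f (at y) v) differentiable (at x)"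
  unfolding c2_on_def by blast

section \<open>Operations that preserve twice differentiability\<close>

lemma c2_on_subset: "c2_on S f \<Longrightarrow> T \<subseteq> S \<Longrightarrow> c2_on T f"
  unfolding c2_on_def by blast

lemma c2_on_const: "c2_on S (\<lambda>x. c)"
  by (simp add: c2_on_def)

lemma c2_on_add:
  assumes f: "c2_on S f" and g: "c2_on S g" and S: "open S"
  shows "c2_on S (\<lambda>x. f x + g x)"
proof (rule c2_onI[OF S])
  show "((\<lambda>x. f x + g x) has_derivative
      (\<lambda>v. frechet_derivative f (at x) v + frechet_derivative g (at x) v)) (at x)" if "x \<in> S" for x
    by (intro has_derivative_add c2_on_has_derivative[OF f] c2_on_has_derivative[OF g] that)
qed (intro differentiable_add c2_on_differentiable2[OF f] c2_on_differentiable2[OF g])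

lemma c2_on_linear:
  assumes L: "bounded_linear L" and f: "c2_on S f" and S: "open S"
  shows "c2_on S (\<lambda>x. L (f x))"
proof (rule c2_onI[OF S])
  show "((\<lambda>x. L (f x)) has_derivative (\<lambda>v. L (frechet_derivative f (at x) v))) (at x)"
    if "x \<in> S" for x
    by (rule bounded_linear.has_derivative[OF L c2_on_has_derivative[OF f that]])
  show "(\<lambda>y. L (frechet_derivative f (at y) v)) differentiable (at x)" if "x \<in> S" for v x
    using c2_on_differentiable2[OF f that, of v] bounded_linear.has_derivative[OF L]
    unfolding differentiable_def by blast
qed

lemma c2_on_of_real: "c2_on S r \<Longrightarrow> open S \<Longrightarrow> c2_on S (\<lambda>w. complex_of_real (r w))"
  by (rule c2_on_linear[OF bounded_linear_of_real])

lemma c2_on_mult: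
  fixes f g :: "'v::real_normed_vector \<Rightarrow> 'w::real_normed_algebra"
  assumes f: "c2_on S f" and g: "c2_on S g" and S: "open S"
  shows "c2_on S (\<lambda>x. f x * g x)"
proof (rule c2_onI[OF S])
  show "((\<lambda>x. f x * g x) has_derivative
      (\<lambda>v. f x * frechet_derivative g (at x) v + frechet_derivative f (at x) v * g x)) (at x)"
    if "x \<in> S" for x
    by (intro has_derivative_mult c2_on_has_derivative[OF f] c2_on_has_derivative[OF g] that)
qed (intro differentiable_add differentiable_mult c2_on_differentiable2[OF f] c2_on_differentiable2[OF g]
    c2_on_differentiable[OF f] c2_on_differentiable[OF g])

lemma c2_on_sum:
  assumes "\<And>i. i \<in> A \<Longrightarrow> c2_on S (f i)" and S: "open S"
  shows "c2_on S (\<lambda>x. \<Sum>i\<in>A. f i x)"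
  using assms(1) by (induction A rule: infinite_finite_induct) (auto intro!: c2_on_const c2_on_add S)

lemma c2_on_prod:
  fixes f :: "'i \<Rightarrow> 'v::real_normed_vector \<Rightarrow> 'w::real_normed_field"
  assumes "\<And>i. i \<in> A \<Longrightarrow> c2_on S (f i)" and S: "open S"
  shows "c2_on S (\<lambda>x. \<Prod>i\<in>A. f i x)"
  using assms(1) by (induction A rule: infinite_finite_induct) (auto intro!: c2_on_const c2_on_mult S)

lemma c2_on_det:
  fixes g :: "'v::real_normed_vector \<Rightarrow> complex^'n^'n"
  assumes g: "c2_on S g" and S: "open S"
  shows "c2_on S (\<lambda>x. det (g x))"
proof -
  have "c2_on S (\<lambda>x. g x $ i $ j)" for i j
    by (rule c2_on_linear[OF bounded_linear_compose[OF bounded_linear_vec_nth bounded_linear_vec_nth] g S])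
  then show ?thesis
    unfolding det_def by (intro c2_on_sum c2_on_mult c2_on_prod c2_on_const S)
qed

text \<open>Derivatives of \<open>F\<close> are demanded only at values of \<open>r\<close>. This
  admits outer functions such as \<open>ln\<close> or the functions of \<open>t\<close> below, which
  are well behaved only on an interval.\<close>

lemma c2_on_real_compose:
  fixes r :: "'v::real_normed_vector \<Rightarrow> real"
  assumes r: "c2_on S r" and S: "open S"
    and F: "\<And>x. x \<in> S \<Longrightarrow> (F has_real_derivative F1 (r x)) (at (r x))"
    and F1: "\<And>x. x \<in> S \<Longrightarrow> (F1 has_real_derivative F2 (r x)) (at (r x))"
  shows "c2_on S (\<lambda>x. F (r x))"
proof (rule c2_onI[OF S])
  show "((\<lambda>x. F (r x)) has_derivative (\<lambda>v. F1 (r x) * frechet_derivative r (at x) v)) (at x)"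
    if "x \<in> S" for x
    using has_derivative_compose[OF c2_on_has_derivative[OF r that], of F] F[OF that]
    by (simp add: has_field_derivative_def)
  have F1r: "(\<lambda>x. F1 (r x)) differentiable (at x)" if "x \<in> S" for x
    using has_derivative_compose[OF c2_on_has_derivative[OF r that], of F1] F1[OF that]
    unfolding has_field_derivative_def differentiable_def by blast
  show "(\<lambda>y. F1 (r y) * frechet_derivative r (at y) v) differentiable (at x)" if "x \<in> S" for v x
    by (intro differentiable_mult c2_on_differentiable2[OF r] F1r that)
qed

lemma c2_on_ln:
  fixes r :: "'v::real_normed_vector \<Rightarrow> real"
  assumes "c2_on S r" "open S" "\<And>x. x \<in> S \<Longrightarrow> 0 < r x"
  shows "c2_on S (\<lambda>x. ln (r x))"
proof (rule c2_on_real_compose[OF assms(1,2)])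
  show "(ln has_real_derivative inverse (r x)) (at (r x))" if "x \<in> S" for x
    using assms(3)[OF that] by (rule DERIV_ln)
  show "(inverse has_real_derivative - (inverse (r x) * inverse (r x))) (at (r x))" if "x \<in> S" for x
    using assms(3)[OF that] by (auto intro!: derivative_eq_intros simp: power2_eq_square)
qed

lemma c2_on_linear_precompose:
  assumes f: "c2_on S f" and S: "open S" and L: "bounded_linear L" and "open T" "\<And>x. x \<in> T \<Longrightarrow> L x \<in> S"
  shows "c2_on T (\<lambda>x. f (L x))"
proof (rule c2_onI[OF assms(4)])
  have L': "(L has_derivative L) (at x)" for x by (rule bounded_linear_imp_has_derivative[OF L])
  show "((\<lambda>x. f (L x)) has_derivative (\<lambda>v. frechet_derivative f (at (L x)) (L v))) (at x)"
    if "x \<in> T" for x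
    by (rule has_derivative_compose[OF L' c2_on_has_derivative[OF f assms(5)[OF that]]])
  show "(\<lambda>y. frechet_derivative f (at (L y)) (L v)) differentiable (at x)" if "x \<in> T" for v x
    using c2_on_differentiable2[OF f assms(5)[OF that], of "L v"] has_derivative_compose[OF L']
    unfolding differentiable_def by blast
qed

text \<open>Both mixed second derivatives are the limit of the symmetric second difference quotient
  \<open>\<Delta> / t\<^sup>2\<close>.\<close>

lemma second_difference_tendsto:
  fixes r :: "'v::real_normed_vector \<Rightarrow> real"
  assumes r: "c2_on S r" and S: "open S" and x: "x \<in> S"
  shows "((\<lambda>t. (r (x + t *\<^sub>R u + t *\<^sub>R v) - r (x + t *\<^sub>R u) - r (x + t *\<^sub>R v) + r x) / t\<^sup>2)
    \<longlongrightarrow> frechet_derivative (\<lambda>y. frechet_derivative r (at y) u) (at x) v) (at_right 0)"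
proof (rule tendstoI)
  fix e :: real assume e: "e > 0"
  define G where "G y = frechet_derivative r (at y) u" for y
  define A where "A = frechet_derivative G (at x)"
  \<comment> \<open>The final error is at most \<open>d * (2 * norm u + norm v)\<close>: one
    expansion is made at a point of size \<open>t (norm u + norm v)\<close>, the other at one of
    size \<open>t * norm u\<close>. The summand 1 keeps \<open>K\<close> positive even if both
    vectors vanish.\<close>
  define K where "K = 2 * norm u + norm v + 1"
  have K: "K > 0" by (auto simp: K_def intro: add_nonneg_pos)
  have A: "(G has_derivative A) (at x)"
    using c2_on_differentiable2[OF r x, of u] unfolding A_def G_def using frechet_derivative_works by blast
  interpret A: bounded_linear A by (rule has_derivative_bounded_linear[OF A])
  define d where "d = e / (2 * K)"
  have d: "d > 0" using e K by (simp add: d_def)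
  obtain \<delta> where \<delta>: "\<delta> > 0"
    "\<And>y. norm (y - x) < \<delta> \<Longrightarrow> norm (G y - G x - A (y - x)) \<le> d * norm (y - x)"
    using A d unfolding has_derivative_at_alt by blast
  obtain \<eta> where \<eta>: "\<eta> > 0" "ball x \<eta> \<subseteq> S" using S x openE by blast
  define t0 where "t0 = min \<delta> \<eta> / K"
  have t0: "t0 > 0" using \<delta>(1) \<eta>(1) K by (simp add: t0_def)
  have main: "\<bar>(r (x + t *\<^sub>R u + t *\<^sub>R v) - r (x + t *\<^sub>R u) - r (x + t *\<^sub>R v) + r x) / t\<^sup>2 - A v\<bar> < e"
    if t: "0 < t" "t < t0" for t
  proof -
    have tK: "t * K < min \<delta> \<eta>" using t(2) K by (simp add: t0_def pos_less_divide_eq)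
    have small: "norm (s *\<^sub>R u + c *\<^sub>R v) \<le> t * (norm u + norm v)"
      if "0 \<le> s" "s \<le> t" "0 \<le> c" "c \<le> t" for s c
    proof -
      have "norm (s *\<^sub>R u + c *\<^sub>R v) \<le> s * norm u + c * norm v"
        using that by (metis abs_of_nonneg norm_scaleR norm_triangle_ineq)
      also have "\<dots> \<le> t * norm u + t * norm v" using that by (intro add_mono mult_right_mono) auto
      finally show ?thesis by (simp add: distrib_left)
    qed
    have "t * (norm u + norm v) \<le> t * K" using t(1) by (simp add: K_def)
    then have small': "norm (s *\<^sub>R u + c *\<^sub>R v) < min \<delta> \<eta>"
      if "0 \<le> s" "s \<le> t" "0 \<le> c" "c \<le> t" for s c
      using small[OF that] tK by linarith
    have inS: "x + s *\<^sub>R u + c *\<^sub>R v \<in> S" if "0 \<le> s" "s \<le> t" "0 \<le> c" "c \<le> t" for s c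
      using small'[OF that] \<eta>(2) by (auto simp: dist_norm add.assoc subset_iff norm_minus_commute)
    have der: "((\<lambda>s. r (x + s *\<^sub>R u + c *\<^sub>R v)) has_real_derivative G (x + s *\<^sub>R u + c *\<^sub>R v)) (at s)"
      if "0 \<le> s" "s \<le> t" "0 \<le> c" "c \<le> t" for s c
    proof -
      have "((\<lambda>s. x + s *\<^sub>R u + c *\<^sub>R v) has_derivative (\<lambda>h. h *\<^sub>R u)) (at s)"
        by (auto intro!: derivative_eq_intros)
      from has_derivative_compose[OF this c2_on_has_derivative[OF r inS[OF that]]]
      have "((\<lambda>s. r (x + s *\<^sub>R u + c *\<^sub>R v)) has_derivative
          (\<lambda>h. frechet_derivative r (at (x + s *\<^sub>R u + c *\<^sub>R v)) (h *\<^sub>R u))) (at s)" .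
      moreover have "frechet_derivative r (at (x + s *\<^sub>R u + c *\<^sub>R v)) (h *\<^sub>R u) =
          G (x + s *\<^sub>R u + c *\<^sub>R v) * h" for h
        using linear_frechet_derivative[OF c2_on_differentiable[OF r inS[OF that]]]
        by (simp add: G_def linear_cmul mult.commute)
      ultimately show ?thesis by (simp add: has_field_derivative_def)
    qed
    \<comment> \<open>The second difference is the increment of \<open>p\<close> over
      \<open>[0, t]\<close>. The mean value theorem in \<open>s\<close> uses up one derivative and
      leaves a difference of the first derivative \<open>G\<close>.\<close>
    define p where "p s = r (x + s *\<^sub>R u + t *\<^sub>R v) - r (x + s *\<^sub>R u + 0 *\<^sub>R v)" for s
    define q where "q s = G (x + s *\<^sub>R u + t *\<^sub>R v) - G (x + s *\<^sub>R u + 0 *\<^sub>R v)" for s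
    have "(p has_real_derivative q s) (at s)" if "0 \<le> s" "s \<le> t" for s
      unfolding p_def q_def using that t(1) by (intro DERIV_diff der) auto
    from MVT2[OF t(1) this] obtain \<xi> where \<xi>: "0 < \<xi>" "\<xi> < t" and mvt: "p t - p 0 = (t - 0) * q \<xi>"
      by blast
    \<comment> \<open>Both values of \<open>G\<close> are expanded around \<open>x\<close> and not
      around each other, so differentiability of \<open>G\<close> at the single point
      \<open>x\<close> suffices.\<close>
    define R where "R h = G (x + h) - G x - A h" for h
    have R: "\<bar>R (s *\<^sub>R u + c *\<^sub>R v)\<bar> \<le> d * (t * (norm u + norm v))"
      if "0 \<le> s" "s \<le> t" "0 \<le> c" "c \<le> t" for s c
    proof -
      have "\<bar>R (s *\<^sub>R u + c *\<^sub>R v)\<bar> \<le> d * norm (s *\<^sub>R u + c *\<^sub>R v)"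
        using \<delta>(2)[of "x + (s *\<^sub>R u + c *\<^sub>R v)"] small'[OF that] by (simp add: R_def)
      also have "\<dots> \<le> d * (t * (norm u + norm v))" using small[OF that] d by simp
      finally show ?thesis .
    qed
    have "\<bar>R (\<xi> *\<^sub>R u)\<bar> \<le> d * (\<xi> * norm u)"
      using \<delta>(2)[of "x + \<xi> *\<^sub>R u"] small'[of \<xi> 0] \<xi> t(1) by (simp add: R_def)
    also have "\<dots> \<le> d * (t * norm u)" using d \<xi> by (intro mult_left_mono mult_right_mono) auto
    finally have R2: "\<bar>R (\<xi> *\<^sub>R u)\<bar> \<le> d * (t * norm u)" .
    have R1: "\<bar>R (\<xi> *\<^sub>R u + t *\<^sub>R v)\<bar> \<le> d * (t * (norm u + norm v))"
      using R[of \<xi> t] \<xi> t(1) by simp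
    have "G (x + \<xi> *\<^sub>R u + t *\<^sub>R v) - G (x + \<xi> *\<^sub>R u) = t * A v + R (\<xi> *\<^sub>R u + t *\<^sub>R v) - R (\<xi> *\<^sub>R u)"
      by (simp add: R_def A.add A.scaleR add.assoc)
    then have "r (x + t *\<^sub>R u + t *\<^sub>R v) - r (x + t *\<^sub>R u) - r (x + t *\<^sub>R v) + r x
        = t * (t * A v + R (\<xi> *\<^sub>R u + t *\<^sub>R v) - R (\<xi> *\<^sub>R u))"
      using mvt by (simp add: p_def q_def)
    moreover have "t * (t * b + c - c') / t\<^sup>2 - b = (c - c') / t" for b c c'
      using t(1) by (simp add: power2_eq_square field_simps)
    ultimately have "(r (x + t *\<^sub>R u + t *\<^sub>R v) - r (x + t *\<^sub>R u) - r (x + t *\<^sub>R v) + r x) / t\<^sup>2 - A v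
        = (R (\<xi> *\<^sub>R u + t *\<^sub>R v) - R (\<xi> *\<^sub>R u)) / t"
      by simp
    also have "\<bar>\<dots>\<bar> \<le> (d * (t * (norm u + norm v)) + d * (t * norm u)) / t"
      using R1 R2 t(1) by (simp add: divide_right_mono)
    also have "\<dots> = d * (2 * norm u + norm v)" using t(1) by (simp add: field_simps)
    also have "\<dots> \<le> d * K" using d by (simp add: K_def)
    also have "\<dots> < e" using K e by (simp add: d_def)
    finally show ?thesis .
  qed
  show "\<forall>\<^sub>F t in at_right 0. dist ((r (x + t *\<^sub>R u + t *\<^sub>R v) - r (x + t *\<^sub>R u) - r (x + t *\<^sub>R v) + r x) / t\<^sup>2)
      (frechet_derivative (\<lambda>y. frechet_derivative r (at y) u) (at x) v) < e"
    using main t0 unfolding A_def G_def dist_real_def eventually_at_right_field by blast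
qed

lemma second_derivative_symmetric:
  fixes r :: "'v::real_normed_vector \<Rightarrow> real"
  assumes "c2_on S r" "open S" "x \<in> S"
  shows "frechet_derivative (\<lambda>y. frechet_derivative r (at y) u) (at x) v =
    frechet_derivative (\<lambda>y. frechet_derivative r (at y) v) (at x) u"
proof (rule tendsto_unique[OF _ second_difference_tendsto[OF assms, of u v]])
  show "((\<lambda>t. (r (x + t *\<^sub>R u + t *\<^sub>R v) - r (x + t *\<^sub>R u) - r (x + t *\<^sub>R v) + r x) / t\<^sup>2)
    \<longlongrightarrow> frechet_derivative (\<lambda>y. frechet_derivative r (at y) v) (at x) u) (at_right 0)"
    using second_difference_tendsto[OF assms, of v u] by (simp add: algebra_simps)
qed simp

section \<open>Wirtinger derivatives\<close>

lemma del_eq: "(u has_derivative D) (at z) \<Longrightarrow> del i u z = (D (axis i 1) - \<i> * D (axis i \<i>)) / 2"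
  unfolding del_def by (metis frechet_derivative_at)

lemma delbar_eq: "(u has_derivative D) (at z) \<Longrightarrow> delbar i u z = (D (axis i 1) + \<i> * D (axis i \<i>)) / 2"
  unfolding delbar_def by (metis frechet_derivative_at)

lemma del_cong_open:
  assumes "open S" "z \<in> S" "\<And>w. w \<in> S \<Longrightarrow> u w = v w"
  shows "del i u z = del i v z" "delbar i u z = delbar i v z"
proof -
  have "(u has_derivative D) (at z) \<longleftrightarrow> (v has_derivative D) (at z)" for D
    using has_derivative_transform_within_open[of u D z UNIV S v]
      has_derivative_transform_within_open[of v D z UNIV S u] assms by auto
  then have "frechet_derivative u (at z) = frechet_derivative v (at z)"
    by (simp add: frechet_derivative_def)
  then show "del i u z = del i v z" "delbar i u z = delbar i v z"
    by (simp_all add: del_def delbar_def)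
qed

lemma i_ddbar_cong_open:
  assumes "open S" "z \<in> S" "\<And>w. w \<in> S \<Longrightarrow> u w = v w"
  shows "i_ddbar u z = i_ddbar v z"
proof -
  have "del i (delbar j u) z = del i (delbar j v) z" for i j
    using assms by (intro del_cong_open[of S]) (auto intro: del_cong_open(2)[of S])
  then show ?thesis by (simp add: i_ddbar_def)
qed

lemma del_add:
  assumes "u differentiable (at z)" "v differentiable (at z)"
  shows "del i (\<lambda>w. u w + v w) z = del i u z + del i v z"
    "delbar i (\<lambda>w. u w + v w) z = delbar i u z + delbar i v z"
proof -
  obtain D E where *: "(u has_derivative D) (at z)" "(v has_derivative E) (at z)"
    using assms by (auto simp: differentiable_def)
  show "del i (\<lambda>w. u w + v w) z = del i u z + del i v z"
    "delbar i (\<lambda>w. u w + v w) z = delbar i u z + delbar i v z"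
    unfolding del_eq[OF has_derivative_add[OF *]] delbar_eq[OF has_derivative_add[OF *]]
      del_eq[OF *(1)] del_eq[OF *(2)] delbar_eq[OF *(1)] delbar_eq[OF *(2)]
    by (simp_all add: algebra_simps add_divide_distrib diff_divide_distrib)
qed

lemma del_mult:
  assumes "u differentiable (at z)" "v differentiable (at z)"
  shows "del i (\<lambda>w. u w * v w) z = del i u z * v z + u z * del i v z"
proof -
  obtain D E where *: "(u has_derivative D) (at z)" "(v has_derivative E) (at z)"
    using assms by (auto simp: differentiable_def)
  show ?thesis
    unfolding del_eq[OF has_derivative_mult[OF *]] del_eq[OF *(1)] del_eq[OF *(2)]
    by (simp add: field_simps)
qed

lemma del_const [simp]: "del i (\<lambda>w. c) z = 0" "delbar i (\<lambda>w. c) z = 0"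
  by (simp_all add: del_def delbar_def)

lemma delbar_differentiable:
  assumes "c2_on S u" "z \<in> S"
  shows "delbar i u differentiable (at z)"
  unfolding delbar_def
  by (intro differentiable_divide differentiable_add differentiable_mult
      c2_on_differentiable2[OF assms] differentiable_const) auto

lemma i_ddbar_add:
  assumes u: "c2_on S u" and v: "c2_on S v" and S: "open S" and z: "z \<in> S"
  shows "i_ddbar (\<lambda>w. u w + v w) z = i_ddbar u z + i_ddbar v z"
proof -
  have "del i (delbar j (\<lambda>w. u w + v w)) z = del i (\<lambda>w. delbar j u w + delbar j v w) z" for i j
    by (rule del_cong_open[OF S z])
      (intro del_add c2_on_differentiable[OF u] c2_on_differentiable[OF v], assumption+)
  also have "\<dots> i j = del i (delbar j u) z + del i (delbar j v) z" for i j
    by (intro del_add delbar_differentiable[OF u] delbar_differentiable[OF v] z)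
  finally show ?thesis by (simp add: i_ddbar_def vec_eq_iff distrib_left)
qed

lemma i_ddbar_const: "i_ddbar (\<lambda>w. c) z = 0"
proof -
  have *: "delbar j (\<lambda>w. c) = (\<lambda>z. 0)" for j by (rule ext) simp
  show ?thesis by (simp add: i_ddbar_def * vec_eq_iff)
qed

lemma has_derivative_of_real_compose:
  assumes "(r has_derivative D) (at z)"
  shows "((\<lambda>w. complex_of_real (r w)) has_derivative (\<lambda>v. complex_of_real (D v))) (at z)"
  by (rule bounded_linear.has_derivative[OF bounded_linear_of_real assms])

lemma delbar_of_real:
  assumes "r differentiable (at z)"
  shows "delbar i (\<lambda>w. complex_of_real (r w)) z = cnj (del i (\<lambda>w. complex_of_real (r w)) z)"
proof -
  obtain D where "(r has_derivative D) (at z)" using assms by (auto simp: differentiable_def)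
  note * = has_derivative_of_real_compose[OF this]
  show ?thesis by (simp add: del_eq[OF *] delbar_eq[OF *])
qed

lemma del_real_compose:
  assumes r: "r differentiable (at z)" and F: "(F has_real_derivative c) (at (r z))"
  shows "del i (\<lambda>w. complex_of_real (F (r w))) z = of_real c * del i (\<lambda>w. complex_of_real (r w)) z"
    "delbar i (\<lambda>w. complex_of_real (F (r w))) z = of_real c * delbar i (\<lambda>w. complex_of_real (r w)) z"
proof -
  obtain D where D: "(r has_derivative D) (at z)" using r by (auto simp: differentiable_def)
  have "((\<lambda>w. F (r w)) has_derivative (\<lambda>v. c * D v)) (at z)"
    using has_derivative_compose[OF D] F by (simp add: has_field_derivative_def)
  note * = has_derivative_of_real_compose[OF this] has_derivative_of_real_compose[OF D]
  show "del i (\<lambda>w. complex_of_real (F (r w))) z = of_real c * del i (\<lambda>w. complex_of_real (r w)) z"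
    "delbar i (\<lambda>w. complex_of_real (F (r w))) z = of_real c * delbar i (\<lambda>w. complex_of_real (r w)) z"
    unfolding del_eq[OF *(1)] del_eq[OF *(2)] delbar_eq[OF *(1)] delbar_eq[OF *(2)]
    by (simp_all add: algebra_simps)
qed

text \<open>The chain rule behind every second-order computation below. The factor 2 is the one
  built into \<open>i_ddbar\<close>, and the conjugate appears because \<open>r\<close> is
  real.\<close>

lemma i_ddbar_real_compose:
  assumes r: "c2_on S r" and S: "open S" and z: "z \<in> S"
    and F: "\<And>x. x \<in> S \<Longrightarrow> (F has_real_derivative F1 (r x)) (at (r x))"
    and F1: "(F1 has_real_derivative c) (at (r z))"
  shows "i_ddbar (\<lambda>w. complex_of_real (F (r w))) z $ i $ j =
    of_real (F1 (r z)) * i_ddbar (\<lambda>w. complex_of_real (r w)) z $ i $ j +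
    2 * of_real c * del i (\<lambda>w. complex_of_real (r w)) z * cnj (del j (\<lambda>w. complex_of_real (r w)) z)"
proof -
  let ?r = "\<lambda>w. complex_of_real (r w)"
  have r': "c2_on S ?r" by (rule c2_on_linear[OF bounded_linear_of_real r S])
  have "(\<lambda>w. F1 (r w)) differentiable (at z)"
    using has_derivative_compose[OF c2_on_has_derivative[OF r z], of F1] F1
    unfolding has_field_derivative_def differentiable_def by blast
  then have d: "(\<lambda>w. complex_of_real (F1 (r w))) differentiable (at z)"
    unfolding differentiable_def using has_derivative_of_real_compose by blast
  have "del i (delbar j (\<lambda>w. complex_of_real (F (r w)))) z = del i (\<lambda>w. of_real (F1 (r w)) * delbar j ?r w) z"
    by (rule del_cong_open[OF S z]) (intro del_real_compose F c2_on_differentiable[OF r])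
  also have "\<dots> = del i (\<lambda>w. of_real (F1 (r w))) z * delbar j ?r z + of_real (F1 (r z)) * del i (delbar j ?r) z"
    by (rule del_mult[OF d delbar_differentiable[OF r' z]])
  also have "del i (\<lambda>w. of_real (F1 (r w))) z = of_real c * del i ?r z"
    by (rule del_real_compose(1)[OF c2_on_differentiable[OF r z] F1])
  also have "delbar j ?r z = cnj (del j ?r z)" by (rule delbar_of_real[OF c2_on_differentiable[OF r z]])
  finally show ?thesis by (simp add: i_ddbar_def algebra_simps)
qed

text \<open>For real \<open>r\<close> this is the symmetry of the real Hessian. It makes the
  curvature form and the Ricci form Hermitian, and through them the values of \<open>Q\<close> and
  \<open>P\<close> real.\<close>

lemma i_ddbar_hermitian:
  assumes r: "c2_on S r" and S: "open S" and z: "z \<in> S"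
  shows "hermitian (i_ddbar (\<lambda>w. complex_of_real (r w)) z)"
proof -
  define H where "H v u = frechet_derivative (\<lambda>y. frechet_derivative r (at y) u) (at z) v" for u v
  have H: "((\<lambda>y. frechet_derivative r (at y) u) has_derivative (\<lambda>v. H v u)) (at z)" for u
    using c2_on_differentiable2[OF r z, of u] unfolding H_def using frechet_derivative_works by blast
  have sym: "H v u = H u v" for u v unfolding H_def by (rule second_derivative_symmetric[OF r S z])
  have *: "del i (delbar j (\<lambda>w. complex_of_real (r w))) z =
     (of_real (H (axis i 1) (axis j 1)) + \<i> * of_real (H (axis i 1) (axis j \<i>)) -
      \<i> * (of_real (H (axis i \<i>) (axis j 1)) + \<i> * of_real (H (axis i \<i>) (axis j \<i>)))) / 4" for i j
  proof -
    have "del i (delbar j (\<lambda>w. complex_of_real (r w))) z = del i (\<lambda>w.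
        (of_real (frechet_derivative r (at w) (axis j 1)) + \<i> * of_real (frechet_derivative r (at w) (axis j \<i>))) / 2) z"
      by (rule del_cong_open[OF S z])
        (rule delbar_eq[OF has_derivative_of_real_compose[OF c2_on_has_derivative[OF r]]])
    moreover have "((\<lambda>w. (complex_of_real (frechet_derivative r (at w) (axis j 1)) +
          \<i> * of_real (frechet_derivative r (at w) (axis j \<i>))) / 2) has_derivative
        (\<lambda>v. (of_real (H v (axis j 1)) + \<i> * of_real (H v (axis j \<i>))) / 2)) (at z)"
      by (intro bounded_linear.has_derivative[OF bounded_linear_divide] has_derivative_add
          bounded_linear.has_derivative[OF bounded_linear_mult_right] has_derivative_of_real_compose H)
    ultimately show ?thesis by (simp add: del_eq add_divide_distrib diff_divide_distrib)
  qed
  show ?thesis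
    unfolding hermitian_def
  proof (intro allI)
    fix i j
    show "i_ddbar (\<lambda>w. complex_of_real (r w)) z $ i $ j = cnj (i_ddbar (\<lambda>w. complex_of_real (r w)) z $ j $ i)"
      by (simp add: i_ddbar_def * sym[of "axis i 1" "axis j 1"] sym[of "axis i 1" "axis j \<i>"]
          sym[of "axis i \<i>" "axis j 1"] sym[of "axis i \<i>" "axis j \<i>"] algebra_simps)
  qed
qed

section \<open>Functions pulled back from the base\<close>

definition base_part :: "complex^('m option) \<Rightarrow> complex^'m" where
  "base_part w = (\<chi> i. w $ Some i)"

lemma bounded_linear_base_part: "bounded_linear (base_part :: complex^('m::finite option) \<Rightarrow> complex^'m)"
  unfolding base_part_def linear_conv_bounded_linear[symmetric]
  by (rule linearI) (simp_all add: vec_eq_iff)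

lemma base_part_axis [simp]: "base_part (axis (Some i) c) = axis i c" "base_part (axis None c) = 0"
  by (simp_all add: base_part_def axis_def vec_eq_iff)

lemma has_derivative_base_part:
  fixes v :: "complex^'m::finite \<Rightarrow> 'w::real_normed_vector"
  assumes "(v has_derivative D) (at (base_part w))"
  shows "((\<lambda>w. v (base_part w)) has_derivative (\<lambda>h. D (base_part h))) (at w)"
  by (rule has_derivative_compose[OF bounded_linear_imp_has_derivative[OF bounded_linear_base_part] assms])

lemma del_base_part:
  fixes v :: "complex^'m::finite \<Rightarrow> complex"
  assumes "v differentiable (at (base_part w))"
  shows "del (Some i) (\<lambda>w. v (base_part w)) w = del i v (base_part w)"
    "delbar (Some i) (\<lambda>w. v (base_part w)) w = delbar i v (base_part w)"
    "del None (\<lambda>w. v (base_part w)) w = 0"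
    "delbar None (\<lambda>w. v (base_part w)) w = 0"
proof -
  obtain D where D: "(v has_derivative D) (at (base_part w))" using assms by (auto simp: differentiable_def)
  note * = has_derivative_base_part[OF D]
  have "D 0 = 0" using has_derivative_bounded_linear[OF D] by (simp add: linear_simps)
  then show "del (Some i) (\<lambda>w. v (base_part w)) w = del i v (base_part w)"
    "delbar (Some i) (\<lambda>w. v (base_part w)) w = delbar i v (base_part w)"
    "del None (\<lambda>w. v (base_part w)) w = 0"
    "delbar None (\<lambda>w. v (base_part w)) w = 0"
    unfolding del_eq[OF *] delbar_eq[OF *] del_eq[OF D] delbar_eq[OF D] by simp_all
qed

lemma open_base_part_vimage: "open S \<Longrightarrow> open {w. base_part w \<in> S}"
  using open_vimage[OF _ linear_continuous_on[OF bounded_linear_base_part], of S]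
  by (simp add: vimage_def)

lemma c2_on_base_part:
  "c2_on S v \<Longrightarrow> open S \<Longrightarrow> open T \<Longrightarrow> (\<And>w. w \<in> T \<Longrightarrow> base_part w \<in> S) \<Longrightarrow> c2_on T (\<lambda>w. v (base_part w))"
  by (rule c2_on_linear_precompose[OF _ _ bounded_linear_base_part])

lemma i_ddbar_base_part:
  assumes v: "c2_on S v" and S: "open S" and w: "base_part w \<in> S"
  shows "i_ddbar (\<lambda>w. v (base_part w)) w = block 0 (i_ddbar v (base_part w))"
proof -
  let ?T = "{w. base_part w \<in> S}"
  have T: "open ?T" "w \<in> ?T" using open_base_part_vimage[OF S] w by auto
  have 1: "del i (delbar (Some j) (\<lambda>w. v (base_part w))) w = del i (\<lambda>w. delbar j v (base_part w)) w" for i j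
    by (rule del_cong_open[OF T]) (simp add: del_base_part c2_on_differentiable[OF v])
  have 2: "del i (delbar None (\<lambda>w. v (base_part w))) w = del i (\<lambda>w. 0) w" for i
    by (rule del_cong_open[OF T]) (simp add: del_base_part c2_on_differentiable[OF v])
  show ?thesis
    by (rule matrix_option_eqI)
      (simp_all add: i_ddbar_def 1 2 del_base_part[OF delbar_differentiable[OF v w]])
qed

section \<open>The logarithm of the fibre coordinate\<close>

lemma has_derivative_ln_cmod_sq:
  fixes w :: "complex^('m::finite option)"
  assumes "w $ None \<noteq> 0"
  shows "((\<lambda>w. ln ((cmod (w $ None))\<^sup>2)) has_derivative (\<lambda>v. 2 * Re (v $ None / w $ None))) (at w)"
proof -
  let ?z = "w $ None"
  have "((\<lambda>w. (w $ None) \<bullet> (w $ None)) has_derivative (\<lambda>v. ?z \<bullet> v $ None + v $ None \<bullet> ?z)) (at w)"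
    by (intro has_derivative_inner bounded_linear_imp_has_derivative bounded_linear_vec_nth)
  then have "((\<lambda>w. (cmod (w $ None))\<^sup>2) has_derivative (\<lambda>v. 2 * (?z \<bullet> v $ None))) (at w)"
    by (simp add: power2_norm_eq_inner inner_commute)
  moreover have "(ln has_derivative (\<lambda>h. inverse ((cmod ?z)\<^sup>2) * h)) (at ((cmod ?z)\<^sup>2))"
    using DERIV_ln[of "(cmod ?z)\<^sup>2"] assms by (simp add: has_field_derivative_def)
  ultimately have "((\<lambda>w. ln ((cmod (w $ None))\<^sup>2)) has_derivative
      (\<lambda>v. inverse ((cmod ?z)\<^sup>2) * (2 * (?z \<bullet> v $ None)))) (at w)"
    by (rule has_derivative_compose)
  moreover have "inverse ((cmod ?z)\<^sup>2) * (2 * (?z \<bullet> v)) = 2 * Re (v / ?z)" for v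
    by (simp add: Re_divide inner_complex_def cmod_power2 field_simps)
  ultimately show ?thesis by simp
qed

lemma del_ln_cmod_sq:
  fixes w :: "complex^('m::finite option)"
  assumes "w $ None \<noteq> 0"
  shows "del None (\<lambda>w. complex_of_real (ln ((cmod (w $ None))\<^sup>2))) w = 1 / w $ None"
    "delbar None (\<lambda>w. complex_of_real (ln ((cmod (w $ None))\<^sup>2))) w = cnj (1 / w $ None)"
    "del (Some i) (\<lambda>w. complex_of_real (ln ((cmod (w $ None))\<^sup>2))) w = 0"
    "delbar (Some i) (\<lambda>w. complex_of_real (ln ((cmod (w $ None))\<^sup>2))) w = 0"
proof -
  note * = has_derivative_of_real_compose[OF has_derivative_ln_cmod_sq[OF assms]]
  have ax: "axis (Some i) c $ None = (0::complex)" "axis None c $ None = c" for c :: complex and i :: 'm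
    by (simp_all add: axis_def)
  define a where "a = 1 / w $ None"
  have a: "c / w $ None = c * a" for c by (simp add: a_def)
  show "del None (\<lambda>w. complex_of_real (ln ((cmod (w $ None))\<^sup>2))) w = 1 / w $ None"
    "delbar None (\<lambda>w. complex_of_real (ln ((cmod (w $ None))\<^sup>2))) w = cnj (1 / w $ None)"
    "del (Some i) (\<lambda>w. complex_of_real (ln ((cmod (w $ None))\<^sup>2))) w = 0"
    "delbar (Some i) (\<lambda>w. complex_of_real (ln ((cmod (w $ None))\<^sup>2))) w = 0"
    unfolding del_eq[OF *] delbar_eq[OF *] ax a
    by (simp_all add: complex_eq_iff)
qed

lemma open_fibre_nonzero: "open {w :: complex^('m::finite option). w $ None \<noteq> 0}"
  by (intro open_Collect_neq continuous_intros)

lemma c2_on_ln_cmod_sq: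
  "c2_on {w :: complex^('m::finite option). w $ None \<noteq> 0} (\<lambda>w. ln ((cmod (w $ None))\<^sup>2))"
proof (rule c2_onI[OF open_fibre_nonzero])
  show "((\<lambda>w. ln ((cmod (w $ None))\<^sup>2)) has_derivative (\<lambda>v. 2 * Re (v $ None / x $ None))) (at x)"
    if "x \<in> {w :: complex^('m option). w $ None \<noteq> 0}" for x
    using that by (intro has_derivative_ln_cmod_sq) simp
  show "(\<lambda>y. 2 * Re (v $ None / y $ None)) differentiable (at x)"
    if "x \<in> {w :: complex^('m option). w $ None \<noteq> 0}" for v x
  proof -
    have "((\<lambda>y. v $ None / y $ None) has_derivative (\<lambda>h. - (v $ None * (inverse (x $ None) * h $ None * inverse (x $ None))))) (at x)"
      using that by (auto intro!: derivative_eq_intros bounded_linear_imp_has_derivative bounded_linear_vec_nth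
          simp: fun_eq_iff divide_inverse)
    from bounded_linear.has_derivative[OF bounded_linear_Re this]
    have "(\<lambda>y. Re (v $ None / y $ None)) differentiable (at x)" by (auto simp: differentiable_def)
    then show ?thesis by (intro differentiable_mult) auto
  qed
qed

text \<open>The derivative \<open>\<partial>bar log |z\<^sup>0|\<^sup>2\<close> is the conjugate of
  \<open>1 / z\<^sup>0\<close>, hence antiholomorphic. So the fibre coordinate contributes neither
  to \<open>\<i> \<partial>\<partial>bar t\<close> nor, through the factor
  \<open>|z\<^sup>0|\<^sup>2\<close> in the determinant, to the Ricci form.\<close>

lemma i_ddbar_ln_cmod_sq:
  fixes w :: "complex^('m::finite option)"
  assumes "w $ None \<noteq> 0"
  shows "i_ddbar (\<lambda>w. complex_of_real (ln ((cmod (w $ None))\<^sup>2))) w = 0"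
proof -
  let ?T = "{w :: complex^('m::finite option). w $ None \<noteq> 0}"
  have T: "open ?T" "w \<in> ?T" using open_fibre_nonzero assms by auto
  have 1: "del i (delbar (Some j) (\<lambda>w. complex_of_real (ln ((cmod (w $ None))\<^sup>2)))) w = del i (\<lambda>w. 0) w" for i and j :: 'm
    by (rule del_cong_open[OF T]) (simp add: del_ln_cmod_sq)
  have 2: "del i (delbar None (\<lambda>w. complex_of_real (ln ((cmod (w $ None))\<^sup>2)))) w = del i (\<lambda>w. cnj (inverse (w $ None))) w" for i
    by (rule del_cong_open[OF T]) (simp add: del_ln_cmod_sq divide_inverse)
  have "((\<lambda>w. cnj (inverse (w $ None))) has_derivative
      (\<lambda>h. cnj (- (inverse (w $ None) * h $ None * inverse (w $ None))))) (at w)"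
    using assms by (intro bounded_linear.has_derivative[OF bounded_linear_cnj] Deriv.has_derivative_inverse
        bounded_linear_imp_has_derivative bounded_linear_vec_nth)
  then have 3: "del i (\<lambda>w. cnj (inverse (w $ None))) w = 0" for i
    by (subst del_eq, assumption) (cases i, simp_all add: axis_def complex_eq_iff)
  have "del i (delbar j (\<lambda>w. complex_of_real (ln ((cmod (w $ None))\<^sup>2)))) w = 0" for i j
    by (cases j) (simp_all only: 1 2 3 del_const)
  then show ?thesis by (simp add: i_ddbar_def vec_eq_iff)
qed

section \<open>The momentum construction\<close>

lemma interval_integral_has_real_derivative:
  fixes g :: "real \<Rightarrow> real"
  assumes J: "open J" "is_interval J" and g: "continuous_on J g" and c: "c \<in> J" and x: "x \<in> J"
  shows "((\<lambda>u. LBINT y=ereal c..ereal u. g y) has_real_derivative g x) (at x)"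
proof -
  \<comment> \<open>The fundamental theorem is applied on one compact interval. Padding the segment
    between \<open>c\<close> and \<open>x\<close> on both sides inside \<open>J\<close> makes
    \<open>x\<close> an interior point of it, so the derivative is two-sided.\<close>
  have "min c x \<in> J" "max c x \<in> J" using c x by (auto simp: min_def max_def)
  obtain e where e: "e > 0" "ball (min c x) e \<subseteq> J" using J(1) \<open>min c x \<in> J\<close> openE by blast
  obtain e' where e': "e' > 0" "ball (max c x) e' \<subseteq> J" using J(1) \<open>max c x \<in> J\<close> openE by blast
  define a b where "a = min c x - e / 2" and "b = max c x + e' / 2"
  have "a \<in> J" "b \<in> J" using e e' by (auto simp: a_def b_def dist_real_def subset_iff)
  then have sub: "{a..b} \<subseteq> J" using J(2) unfolding is_interval_1 by fastforce
  have ab: "a < c" "a < x" "c < b" "x < b" using e e' by (auto simp: a_def b_def)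
  have "((\<lambda>u. LBINT y=ereal c..ereal u. g y) has_vector_derivative g x) (at x within {a..b})"
    using ab continuous_on_subset[OF g sub] by (intro interval_integral_FTC2) auto
  moreover have "at x within {a..b} = at x" using ab by (intro at_within_interior) auto
  ultimately show ?thesis by (simp add: has_real_derivative_iff_has_vector_derivative)
qed

locale momentum_construction =
  fixes I :: "real set" and \<phi> :: "real \<Rightarrow> real" and \<tau>\<^sub>0 :: real
  assumes I: "is_interval I" and cont: "continuous_on (interior I) \<phi>"
    and pos: "x \<in> interior I \<Longrightarrow> 0 < \<phi> x" and \<tau>\<^sub>0: "\<tau>\<^sub>0 \<in> interior I"
begin

abbreviation "time \<tau> \<equiv> profile_time \<phi> \<tau>\<^sub>0 (ereal \<tau>)"

lemma interval: "is_interval (interior I)"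
  using I by (simp add: is_interval_convex_1 convex_interior)

lemma between: "x \<in> interior I \<Longrightarrow> y \<in> interior I \<Longrightarrow> x \<le> z \<Longrightarrow> z \<le> y \<Longrightarrow> z \<in> interior I"
  using interval unfolding is_interval_1 by blast

lemma time_derivative:
  assumes "x \<in> interior I"
  shows "(time has_real_derivative 1 / \<phi> x) (at x)"
  unfolding profile_time_def
  by (rule interval_integral_has_real_derivative[OF open_interior interval _ \<tau>\<^sub>0 assms])
    (intro continuous_intros cont, use pos in force)

lemma time_strict_mono:
  assumes "x \<in> interior I" "y \<in> interior I" "x < y"
  shows "time x < time y"
proof (rule DERIV_pos_imp_increasing[OF assms(3)])
  fix z assume "x \<le> z" "z \<le> y"
  then have "z \<in> interior I" using between assms by blast
  then show "\<exists>d. (time has_real_derivative d) (at z) \<and> 0 < d"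
    using time_derivative[of z] pos[of z] by auto
qed

lemma time_inj: "x \<in> interior I \<Longrightarrow> y \<in> interior I \<Longrightarrow> time x = time y \<Longrightarrow> x = y"
  using time_strict_mono by (metis less_irrefl linorder_neqE_linordered_idom)

lemma smaller: "x \<in> interior I \<Longrightarrow> \<exists>y\<in>interior I. y < x"
  and larger: "x \<in> interior I \<Longrightarrow> \<exists>y\<in>interior I. x < y"
proof -
  assume "x \<in> interior I"
  then obtain e where e: "e > 0" "ball x e \<subseteq> interior I" using open_interior openE by blast
  then have "x - e / 2 \<in> interior I" "x + e / 2 \<in> interior I" by (auto simp: dist_real_def subset_iff)
  moreover have "x - e / 2 < x" "x < x + e / 2" using e(1) by auto
  ultimately show "\<exists>y\<in>interior I. y < x" "\<exists>y\<in>interior I. x < y" by blast+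
qed

text \<open>Since \<open>time\<close> is increasing, its limit at the lower end is its infimum. The
  end may be infinite, so the limit is taken over extended reals.\<close>

lemma time_lower_eq: "time_lower I \<phi> \<tau>\<^sub>0 = (INF \<tau>\<in>interior I. ereal (time \<tau>))"
proof -
  let ?L = "Inf (ereal ` interior I)"
  have L: "?L < ereal x" if "x \<in> interior I" for x
    using smaller[OF that] by (auto simp: Inf_less_iff)
  \<comment> \<open>A point beyond the infimum lies above some member of the interval, and the bound
    \<open>ereal x\<close> excludes infinite values; near the end the filter therefore sees only
    real points of the interval.\<close>
  have eventually_in: "\<exists>r. \<tau> = ereal r \<and> r \<in> interior I \<and> r < x"
    if h: "?L < \<tau>" "\<tau> < ereal x" "x \<in> interior I" for \<tau> x
  proof -
    obtain y where y: "y \<in> interior I" "ereal y < \<tau>" using h(1) unfolding INF_less_iff by blast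
    then obtain r where "\<tau> = ereal r" using h(2) by (cases \<tau>) auto
    then show ?thesis using y h between[of y x r] by auto
  qed
  have "((\<lambda>\<tau>. ereal (profile_time \<phi> \<tau>\<^sub>0 \<tau>)) \<longlongrightarrow> (INF \<tau>\<in>interior I. ereal (time \<tau>))) (at_right ?L)"
  proof (rule decreasing_tendsto)
    show "\<forall>\<^sub>F \<tau> in at_right ?L. (INF \<tau>\<in>interior I. ereal (time \<tau>)) \<le> ereal (profile_time \<phi> \<tau>\<^sub>0 \<tau>)"
      unfolding eventually_at_right[OF L[OF \<tau>\<^sub>0]]
    proof (intro exI conjI allI impI)
      fix \<tau> assume "?L < \<tau>" "\<tau> < ereal \<tau>\<^sub>0"
      then obtain r where "\<tau> = ereal r" "r \<in> interior I" using eventually_in \<tau>\<^sub>0 by blast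
      then show "(INF \<tau>\<in>interior I. ereal (time \<tau>)) \<le> ereal (profile_time \<phi> \<tau>\<^sub>0 \<tau>)"
        by (auto intro: INF_lower)
    qed (rule L[OF \<tau>\<^sub>0])
  next
    fix c assume "(INF \<tau>\<in>interior I. ereal (time \<tau>)) < c"
    then obtain x where x: "x \<in> interior I" "ereal (time x) < c" by (auto simp: INF_less_iff)
    show "\<forall>\<^sub>F \<tau> in at_right ?L. ereal (profile_time \<phi> \<tau>\<^sub>0 \<tau>) < c"
      unfolding eventually_at_right[OF L[OF x(1)]]
    proof (intro exI conjI allI impI)
      fix \<tau> assume "?L < \<tau>" "\<tau> < ereal x"
      then obtain r where "\<tau> = ereal r" "r \<in> interior I" "r < x" using eventually_in x(1) by blast
      then show "ereal (profile_time \<phi> \<tau>\<^sub>0 \<tau>) < c"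
        using time_strict_mono[of r x] x less_trans[of "ereal (time r)" "ereal (time x)" c] by auto
    qed (rule L[OF x(1)])
  qed
  \<comment> \<open>\<open>Lim\<close> is determined by convergence only along a nontrivial
    filter.\<close>
  moreover have "at_right ?L \<noteq> bot"
    unfolding trivial_limit_def eventually_at_right[OF L[OF \<tau>\<^sub>0]] using dense by blast
  ultimately show ?thesis unfolding time_lower_def by (intro tendsto_Lim)
qed

lemma time_upper_eq: "time_upper I \<phi> \<tau>\<^sub>0 = (SUP \<tau>\<in>interior I. ereal (time \<tau>))"
proof -
  let ?U = "Sup (ereal ` interior I)"
  have U: "ereal x < ?U" if "x \<in> interior I" for x
    using larger[OF that] by (auto simp: less_Sup_iff)
  have eventually_in: "\<exists>r. \<tau> = ereal r \<and> r \<in> interior I \<and> x < r"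
    if h: "\<tau> < ?U" "ereal x < \<tau>" "x \<in> interior I" for \<tau> x
  proof -
    obtain y where y: "y \<in> interior I" "\<tau> < ereal y" using h(1) unfolding less_SUP_iff by blast
    then obtain r where "\<tau> = ereal r" using h(2) by (cases \<tau>) auto
    then show ?thesis using y h between[of x y r] by auto
  qed
  have "((\<lambda>\<tau>. ereal (profile_time \<phi> \<tau>\<^sub>0 \<tau>)) \<longlongrightarrow> (SUP \<tau>\<in>interior I. ereal (time \<tau>))) (at_left ?U)"
  proof (rule increasing_tendsto)
    show "\<forall>\<^sub>F \<tau> in at_left ?U. ereal (profile_time \<phi> \<tau>\<^sub>0 \<tau>) \<le> (SUP \<tau>\<in>interior I. ereal (time \<tau>))"
      unfolding eventually_at_left[OF U[OF \<tau>\<^sub>0]]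
    proof (intro exI conjI allI impI)
      fix \<tau> assume "ereal \<tau>\<^sub>0 < \<tau>" "\<tau> < ?U"
      then obtain r where "\<tau> = ereal r" "r \<in> interior I" using eventually_in \<tau>\<^sub>0 by blast
      then show "ereal (profile_time \<phi> \<tau>\<^sub>0 \<tau>) \<le> (SUP \<tau>\<in>interior I. ereal (time \<tau>))"
        by (auto intro: SUP_upper)
    qed (rule U[OF \<tau>\<^sub>0])
  next
    fix c assume "c < (SUP \<tau>\<in>interior I. ereal (time \<tau>))"
    then obtain x where x: "x \<in> interior I" "c < ereal (time x)" by (auto simp: less_SUP_iff)
    show "\<forall>\<^sub>F \<tau> in at_left ?U. c < ereal (profile_time \<phi> \<tau>\<^sub>0 \<tau>)"
      unfolding eventually_at_left[OF U[OF x(1)]]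
    proof (intro exI conjI allI impI)
      fix \<tau> assume "ereal x < \<tau>" "\<tau> < ?U"
      then obtain r where "\<tau> = ereal r" "r \<in> interior I" "x < r" using eventually_in x(1) by blast
      then show "c < ereal (profile_time \<phi> \<tau>\<^sub>0 \<tau>)"
        using time_strict_mono[of x r] x by (auto intro: less_trans)
    qed (rule U[OF x(1)])
  qed
  moreover have "at_left ?U \<noteq> bot"
    unfolding trivial_limit_def eventually_at_left[OF U[OF \<tau>\<^sub>0]] using dense by blast
  ultimately show ?thesis unfolding time_upper_def by (intro tendsto_Lim)
qed

definition times :: "real set" where
  "times = {t. time_lower I \<phi> \<tau>\<^sub>0 < ereal t \<and> ereal t < time_upper I \<phi> \<tau>\<^sub>0}"

text \<open>Intermediate values fill the gap between the infimum and the supremum of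
  \<open>time\<close>. Neither is attained, because the interior has no smallest and no largest
  point.\<close>

lemma times_eq: "times = time ` interior I"
proof (intro set_eqI iffI)
  fix t assume "t \<in> times"
  then obtain x y where x: "x \<in> interior I" "time x < t" and y: "y \<in> interior I" "t < time y"
    by (auto simp: times_def time_lower_eq time_upper_eq INF_less_iff less_SUP_iff)
  have "x \<le> y"
  proof (rule ccontr)
    assume "\<not> x \<le> y"
    then have "time y < time x" using time_strict_mono x(1) y(1) by simp
    then show False using x(2) y(2) by simp
  qed
  moreover have "\<forall>z. x \<le> z \<and> z \<le> y \<longrightarrow> isCont time z"
    using between[OF x(1) y(1)] time_derivative DERIV_isCont by blast
  ultimately obtain z where "x \<le> z" "z \<le> y" "time z = t" using IVT[of time x t y] x y by auto
  then show "t \<in> time ` interior I" using between[OF x(1) y(1)] by blast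
next
  fix t assume "t \<in> time ` interior I"
  then obtain x where x: "x \<in> interior I" "t = time x" by blast
  obtain y z where "y \<in> interior I" "y < x" "z \<in> interior I" "x < z"
    using smaller[OF x(1)] larger[OF x(1)] by blast
  then have "time y < t" "t < time z" using time_strict_mono x by auto
  then show "t \<in> times"
    using \<open>y \<in> _\<close> \<open>z \<in> _\<close> by (auto simp: times_def time_lower_eq time_upper_eq INF_less_iff less_SUP_iff)
qed

lemma open_times: "open times"
  unfolding times_def by (intro open_Collect_conj open_Collect_less continuous_intros)

lemma momentum_time:
  assumes "x \<in> interior I"
  shows "momentum I \<phi> \<tau>\<^sub>0 (time x) = x"
  unfolding momentum_def by (rule the_equality) (use assms time_inj in auto)

lemma momentum_in:
  assumes "t \<in> times"
  shows "momentum I \<phi> \<tau>\<^sub>0 t \<in> interior I" "time (momentum I \<phi> \<tau>\<^sub>0 t) = t"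
  using assms by (auto simp: times_eq momentum_time)

text \<open>\<open>momentum\<close> inverts \<open>time\<close>, whose derivative is
  \<open>1 / \<phi>\<close>. The rule for inverse functions asks for continuity of the inverse
  first, which comes from a compact neighbourhood of the value.\<close>

lemma momentum_derivative:
  assumes t: "t \<in> times"
  shows "(momentum I \<phi> \<tau>\<^sub>0 has_real_derivative \<phi> (momentum I \<phi> \<tau>\<^sub>0 t)) (at t)"
proof -
  let ?x = "momentum I \<phi> \<tau>\<^sub>0 t"
  have x: "?x \<in> interior I" "time ?x = t" using momentum_in[OF t] by auto
  obtain a b where ab: "a \<in> interior I" "a < ?x" "b \<in> interior I" "?x < b"
    using smaller[OF x(1)] larger[OF x(1)] by blast
  have "isCont (momentum I \<phi> \<tau>\<^sub>0) (time ?x)"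
    using ab(2,4)
  proof (rule isCont_inverse_function2)
    fix z assume "a \<le> z" "z \<le> b"
    then have "z \<in> interior I" using between ab by blast
    then show "momentum I \<phi> \<tau>\<^sub>0 (time z) = z" "isCont time z"
      using momentum_time time_derivative DERIV_isCont by blast+
  qed
  then have "isCont (momentum I \<phi> \<tau>\<^sub>0) t" by (simp add: x(2))
  moreover obtain e where e: "e > 0" "ball t e \<subseteq> times" using open_times t openE by blast
  ultimately have "(momentum I \<phi> \<tau>\<^sub>0 has_real_derivative inverse (1 / \<phi> ?x)) (at t)"
  proof (intro DERIV_inverse_function[where f = time and a = "t - e" and b = "t + e"])
    show "time (momentum I \<phi> \<tau>\<^sub>0 s) = s" if "t - e < s" "s < t + e" for s
      using that e(2) by (intro momentum_in) (auto simp: dist_real_def subset_iff)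
    show "(time has_real_derivative 1 / \<phi> ?x) (at ?x)" by (rule time_derivative[OF x(1)])
  qed (use pos[OF x(1)] e(1) in auto)
  then show ?thesis by simp
qed

text \<open>The factor \<phi> from the derivative of the upper limit cancels the denominator of the
  integrand.\<close>

lemma potential_derivative:
  assumes t: "t \<in> times"
  shows "(potential I \<phi> \<tau>\<^sub>0 has_real_derivative momentum I \<phi> \<tau>\<^sub>0 t) (at t)"
proof -
  let ?x = "momentum I \<phi> \<tau>\<^sub>0 t"
  have x: "?x \<in> interior I" using momentum_in[OF t] by auto
  have "((\<lambda>u. LBINT x=ereal \<tau>\<^sub>0..ereal u. x / \<phi> x) has_real_derivative ?x / \<phi> ?x) (at ?x)"
    by (rule interval_integral_has_real_derivative[OF open_interior interval _ \<tau>\<^sub>0 x])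
      (intro continuous_intros cont, use pos in force)
  from DERIV_chain[OF this momentum_derivative[OF t]]
  show ?thesis using pos[OF x] by (simp add: potential_def[abs_def] comp_def)
qed

end

section \<open>Traces and scalar curvature\<close>

text \<open>Powers of a real argument are real, so real parts can be taken coefficientwise.\<close>

lemma map_poly_Re:
  "poly (map_poly Re p) x = Re (poly p (complex_of_real x))"
  by (induction p) (simp_all add: map_poly_pCons)

text \<open>\<open>M\<close> cancels and \<open>R A\<inverse>\<close> is conjugated by
  \<open>N\<close>. Hence scalar curvature may be computed in a frame in which the metric and the
  Ricci form are both block diagonal.\<close>

lemma trace_conjugate:
  fixes N A R M :: "complex^'n^'n"
  assumes "det N \<noteq> 0" "det A \<noteq> 0" "det M \<noteq> 0"
  shows "trace ((N ** R ** M) ** matrix_inv (N ** A ** M)) = trace (R ** matrix_inv A)"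
proof -
  have "(N ** A ** M) ** (matrix_inv M ** matrix_inv A ** matrix_inv N) =
      N ** (A ** (M ** matrix_inv M) ** matrix_inv A) ** matrix_inv N"
    by (simp only: matrix_mul_assoc)
  also have "\<dots> = mat 1" by (simp add: matrix_inv_both assms)
  finally have inv: "matrix_inv (N ** A ** M) = matrix_inv M ** matrix_inv A ** matrix_inv N"
    by (rule matrix_inv_eqI)
  have "(N ** R ** M) ** matrix_inv (N ** A ** M) =
      N ** (R ** (M ** matrix_inv M) ** matrix_inv A) ** matrix_inv N"
    unfolding inv by (simp only: matrix_mul_assoc)
  also have "\<dots> = N ** (R ** matrix_inv A ** matrix_inv N)"
    by (simp add: matrix_inv_both assms matrix_mul_assoc)
  finally have "trace ((N ** R ** M) ** matrix_inv (N ** A ** M)) =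
      trace (N ** (R ** matrix_inv A ** matrix_inv N))"
    by (rule arg_cong)
  also have "\<dots> = trace ((R ** matrix_inv A ** matrix_inv N) ** N)" by (rule trace_mul_sym)
  also have "\<dots> = trace (R ** matrix_inv A ** (matrix_inv N ** N))"
    by (simp only: matrix_mul_assoc)
  finally show ?thesis by (simp add: matrix_inv_both assms)
qed

lemma matrix_inv_block:
  fixes A :: "'a::field^'m::finite^'m"
  assumes "x \<noteq> 0" "det A \<noteq> 0"
  shows "matrix_inv (block x A) = block (1 / x) (matrix_inv A)"
  by (rule matrix_inv_eqI) (simp add: block_mult matrix_inv_both assms block_mat_1)

lemma trace_add_scaled:
  "trace ((A + c *\<^sub>R B) ** C) = trace (A ** C) + of_real c * trace (B ** C)"
  for A B C :: "complex^'n^'n"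
proof -
  have "(c *\<^sub>R B) ** C = c *\<^sub>R (B ** C)" by (simp add: scalar_matrix_assoc)
  moreover have "trace (c *\<^sub>R X) = of_real c * trace X" for X :: "complex^'n^'n"
    by (simp add: trace_def sum_distrib_left scaleR_conv_of_real[where 'a = complex])
  ultimately show ?thesis by (simp add: matrix_add_rdistrib trace_add)
qed

lemma scalar_curvature_eq: "scalar_curvature g z = trace (ricci_form g z ** matrix_inv (g z))"
  by (simp add: scalar_curvature_def form_endo_def trace_transpose)

section \<open>Geometry of the base\<close>

locale horizontal_patch =
  fixes D :: "('a, 'b, 'm::finite) line_bundle_data" and I :: "real set"
    and c :: "('a, 'm) chart" and e :: "'a set \<times> ('b \<Rightarrow> complex)"
  assumes hd: "horizontal_data D I" and c: "c \<in> atlas D" and e: "e \<in> trivs D"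
begin

lemma chart_props:
  "openin (base D) (fst c)" "open (snd c ` fst c)"
  "homeomorphic_map (subtopology (base D) (fst c)) (top_of_set (snd c ` fst c)) (snd c)"
  using hd c unfolding horizontal_data_def complex_manifold_def by blast+

lemma triv_props:
  "openin (base D) (fst e)"
  "homeomorphic_map (subtopology (total D) (bundle_over D (fst e)))
     (prod_topology (subtopology (base D) (fst e)) euclidean) (\<lambda>y. (proj D y, snd e y))"
  using hd e unfolding horizontal_data_def holomorphic_line_bundle_def by blast+

lemma open_patch: "open (patch c e)"
proof -
  have "openin (subtopology (base D) (fst c)) (fst c \<inter> fst e)"
    using openin_subtopology_Int[OF triv_props(1), of "fst c"] by (simp only: Int_commute)
  then have "openin (top_of_set (snd c ` fst c)) (snd c ` (fst c \<inter> fst e))"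
    using homeomorphic_imp_open_map[OF chart_props(3)] unfolding open_map_def by blast
  then show ?thesis unfolding patch_def using chart_props(2) by (rule openin_open_trans)
qed

lemma chart_inj: "inj_on (snd c) (fst c)"
proof -
  have "topspace (subtopology (base D) (fst c)) = fst c"
    using openin_subset[OF chart_props(1)] by auto
  then show ?thesis using homeomorphic_imp_injective_map[OF chart_props(3)] by simp
qed

lemma chart_inv_patch:
  assumes "z \<in> patch c e"
  shows "chart_inv c z \<in> fst c \<inter> fst e" "snd c (chart_inv c z) = z"
  using assms chart_inj by (auto simp: patch_def)

lemma patch_subset: "patch c e \<subseteq> snd c ` fst c"
  by (auto simp: patch_def)

lemma metric_props:
  "smooth_on (snd c ` fst c) (metric D c)" "\<forall>z\<in>snd c ` fst c. positive_herm (metric D c z)"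
proof -
  have *: "kaehler_metric (atlas D) (metric D)" using hd unfolding horizontal_data_def by blast
  show "smooth_on (snd c ` fst c) (metric D c)"
    using bspec[OF *[unfolded kaehler_metric_def, THEN conjunct1] c] .
  show "\<forall>z\<in>snd c ` fst c. positive_herm (metric D c z)"
    using bspec[OF *[unfolded kaehler_metric_def, THEN conjunct2, THEN conjunct1] c] .
qed

lemma metric_c2: "c2_on (patch c e) (metric D c)"
  using c2_on_subset[OF smooth_on_imp_c2_on[OF metric_props(1)] patch_subset] .

lemma metric_positive: "z \<in> patch c e \<Longrightarrow> positive_herm (metric D c z)"
  using metric_props(2) patch_subset by blast

lemma base_metric_positive: "\<tau> \<in> I \<Longrightarrow> z \<in> patch c e \<Longrightarrow> positive_herm (base_metric D \<tau> c e z)"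
  using hd c e unfolding horizontal_data_def by blast

section \<open>The Hermitian structure and its curvature in coordinates\<close>

definition "h z = local_norm D e (chart_inv c z)"

lemma hermitian_structure_e:
  "y \<in> bundle_over D (fst e) \<Longrightarrow> normsq D y = (cmod (snd e y))\<^sup>2 * local_norm D e (proj D y)"
  "x \<in> fst e \<Longrightarrow> 0 < local_norm D e x"
  "smooth_on (patch c e) (local_norm D e \<circ> chart_inv c)"
  using hd c e unfolding horizontal_data_def hermitian_structure_def patch_def by blast+

lemma h_pos: "z \<in> patch c e \<Longrightarrow> 0 < h z"
  using hermitian_structure_e(2) chart_inv_patch(1) by (auto simp: h_def)

lemma c2_ln_h: "c2_on (patch c e) (\<lambda>z. ln (h z))"
proof (rule c2_on_ln[OF _ open_patch h_pos])
  show "c2_on (patch c e) h"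
    using smooth_on_imp_c2_on[OF hermitian_structure_e(3)] by (simp add: h_def[abs_def] comp_def)
qed

lemma curvature_form_eq: "curvature_form D c e z = - i_ddbar (\<lambda>w. complex_of_real (ln (h w))) z"
  by (simp add: curvature_form_def h_def)

lemma curvature_form_hermitian: "z \<in> patch c e \<Longrightarrow> hermitian (curvature_form D c e z)"
  unfolding curvature_form_eq by (intro hermitian_uminus i_ddbar_hermitian[OF c2_ln_h open_patch])

lemma c2_ln_det: "c2_on (patch c e) (\<lambda>z. ln (Re (det (metric D c z))))"
  by (rule c2_on_ln[OF c2_on_linear[OF bounded_linear_Re c2_on_det[OF metric_c2 open_patch] open_patch] open_patch])
    (rule positive_herm_det_pos[OF metric_positive])

lemma ricci_form_hermitian: "z \<in> patch c e \<Longrightarrow> hermitian (ricci_form (metric D c) z)"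
  unfolding ricci_form_def by (intro hermitian_uminus i_ddbar_hermitian[OF c2_ln_det open_patch])

text \<open>Valid for every real \<tau>, whereas positivity is available only on \<open>I\<close>.
  The volume ratio is thereby real for all \<tau>.\<close>

lemma base_metric_hermitian:
  assumes "z \<in> patch c e"
  shows "hermitian (base_metric D \<tau> c e z)"
  unfolding base_metric_def hermitian_def
  using curvature_form_hermitian[OF assms] positive_herm_hermitian[OF metric_positive[OF assms]]
  by (simp add: hermitianD)

lemma det_metric_nonzero: "z \<in> patch c e \<Longrightarrow> det (metric D c z) \<noteq> 0"
  using positive_herm_det_nonzero metric_positive by blast

text \<open>\<open>g\<^sub>M(\<tau>)\<close> with \<tau> as an indeterminate.\<close>

definition metric_poly :: "complex^'m \<Rightarrow> complex poly^'m^'m" where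
  "metric_poly z = (\<chi> i j. [:metric D c z $ i $ j, - curvature_form D c e z $ i $ j:])"

lemma poly_metric_poly:
  "(\<chi> i j. poly (metric_poly z $ i $ j) (of_real \<tau>)) = base_metric D \<tau> c e z"
  by (simp add: vec_eq_iff metric_poly_def base_metric_def scaleR_conv_of_real[where 'a = complex])

text \<open>The candidate for \<open>Q\<close> read off at one point. Its complex form takes real
  values at real \<tau>, so \<open>map_poly Re\<close> changes only the type.\<close>

definition volume_poly :: "complex^'m \<Rightarrow> real poly" where
  "volume_poly z = map_poly Re (smult (inverse (det (metric D c z))) (det (metric_poly z)))"

text \<open>The candidate for \<open>P\<close> read off at one point. The Ricci form of
  \<open>g\<^sub>M\<close> enters with constant entries, since it also serves as the Ricci form of
  every \<open>g\<^sub>M(\<tau>)\<close> once \<open>Q\<close> is known to be constant along the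
  base.\<close>

definition curvature_poly :: "complex^'m \<Rightarrow> real poly" where
  "curvature_poly z = map_poly Re (smult (2 / det (metric D c z))
     (det_derivative (metric_poly z) (\<chi> i j. [:ricci_form (metric D c) z $ i $ j:])))"

lemma volume_ratio_eq_poly:
  assumes z: "z \<in> patch c e"
  shows "volume_ratio D \<tau> c e z = of_real (poly (volume_poly z) \<tau>)"
proof -
  have "Im (det (base_metric D \<tau> c e z)) = 0" "Im (det (metric D c z)) = 0"
    by (simp_all add: hermitian_det_real base_metric_hermitian positive_herm_hermitian metric_positive z)
  then have "Im (volume_ratio D \<tau> c e z) = 0" by (simp add: volume_ratio_def Im_divide)
  moreover have "poly (volume_poly z) \<tau> = Re (volume_ratio D \<tau> c e z)"
    by (simp add: volume_poly_def map_poly_Re poly_det poly_metric_poly volume_ratio_def divide_inverse mult.commute)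
  ultimately show ?thesis by (simp add: complex_eq_iff)
qed

lemma curvature_poly_eq_trace:
  assumes z: "z \<in> patch c e" and nz: "det (base_metric D \<tau> c e z) \<noteq> 0"
  shows "of_real (poly (curvature_poly z) \<tau>) = 2 * volume_ratio D \<tau> c e z *
    trace (ricci_form (metric D c) z ** matrix_inv (base_metric D \<tau> c e z))"
proof -
  let ?\<rho> = "ricci_form (metric D c) z"
  let ?d = "det_derivative (base_metric D \<tau> c e z) ?\<rho>"
  have "Im ?d = 0" "Im (det (metric D c z)) = 0"
    by (simp_all add: hermitian_det_real positive_herm_hermitian metric_positive z
        hermitian_det_derivative_real base_metric_hermitian ricci_form_hermitian)
  then have "Im (2 / det (metric D c z) * ?d) = 0" by (simp add: Im_divide)
  moreover have "poly (curvature_poly z) \<tau> = Re (2 / det (metric D c z) * ?d)"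
    by (simp add: curvature_poly_def map_poly_Re poly_det_derivative poly_metric_poly)
  ultimately have "of_real (poly (curvature_poly z) \<tau>) = 2 / det (metric D c z) * ?d"
    by (simp add: complex_eq_iff)
  also have "?d = det (base_metric D \<tau> c e z) * trace (?\<rho> ** matrix_inv (base_metric D \<tau> c e z))"
    by (rule det_derivative_eq_trace[OF nz])
  finally show ?thesis by (simp add: volume_ratio_def)
qed

end

text \<open>The consequence of constant eigenvalues that the geometry uses. The identity is stated
  for every real \<tau>, so that it can be differentiated from both sides even at an endpoint of
  \<open>I\<close>.\<close>

locale constant_volume_patch = horizontal_patch +
  fixes Q :: "real poly"
  assumes Q: "z \<in> patch c e \<Longrightarrow> volume_ratio D \<tau> c e z = of_real (poly Q \<tau>)"
begin

lemma det_base_metric: "z \<in> patch c e \<Longrightarrow> det (base_metric D \<tau> c e z) = of_real (poly Q \<tau>) * det (metric D c z)"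
  using Q[of z \<tau>] det_metric_nonzero[of z] by (simp add: volume_ratio_def field_simps)

lemma Re_det_base_metric:
  "z \<in> patch c e \<Longrightarrow> Re (det (base_metric D \<tau> c e z)) = poly Q \<tau> * Re (det (metric D c z))"
  by (simp add: det_base_metric)

lemma Q_pos:
  assumes "\<tau> \<in> I" "z \<in> patch c e"
  shows "0 < poly Q \<tau>"
proof -
  have "0 < poly Q \<tau> * Re (det (metric D c z))"
    using positive_herm_det_pos[OF base_metric_positive[OF assms]] assms(2) by (simp add: Re_det_base_metric)
  moreover have "0 < Re (det (metric D c z))" using assms(2) positive_herm_det_pos metric_positive by blast
  ultimately show ?thesis by (simp add: zero_less_mult_iff)
qed

text \<open>For fixed \<tau> the determinants of \<open>g\<^sub>M(\<tau>)\<close> and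
  \<open>g\<^sub>M\<close> differ by the constant factor \<open>Q(\<tau>)\<close>, which
  \<open>\<i> \<partial>\<partial>bar log\<close> annihilates; only the metric used for the trace
  changes.\<close>

lemma scalar_curvature_base_metric:
  assumes \<tau>: "\<tau> \<in> I" and z: "z \<in> patch c e"
  shows "scalar_curvature (base_metric D \<tau> c e) z =
    trace (ricci_form (metric D c) z ** matrix_inv (base_metric D \<tau> c e z))"
proof -
  let ?f = "\<lambda>w. complex_of_real (ln (Re (det (metric D c w))))"
  have f: "c2_on (patch c e) ?f" by (rule c2_on_linear[OF bounded_linear_of_real c2_ln_det open_patch])
  have "ln (Re (det (base_metric D \<tau> c e w))) = ln (poly Q \<tau>) + ln (Re (det (metric D c w)))"
    if "w \<in> patch c e" for w
    unfolding Re_det_base_metric[OF that]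
    by (rule ln_mult_pos) (use Q_pos[OF \<tau> that] positive_herm_det_pos metric_positive that in auto)
  then have "i_ddbar (\<lambda>w. complex_of_real (ln (Re (det (base_metric D \<tau> c e w))))) z =
      i_ddbar (\<lambda>w. of_real (ln (poly Q \<tau>)) + ?f w) z"
    by (intro i_ddbar_cong_open[OF open_patch z]) simp
  also have "\<dots> = i_ddbar ?f z"
    using i_ddbar_add[OF c2_on_const f open_patch z] by (simp add: i_ddbar_const)
  finally show ?thesis by (simp add: scalar_curvature_eq ricci_form_def)
qed

text \<open>Jacobi's formula along the line of matrices \<open>g\<^sub>M(\<tau> + s)\<close>, whose
  velocity is \<open>-\<gamma>\<close>.\<close>

lemma Q_derivative:
  assumes z: "z \<in> patch c e" and nz: "poly Q \<tau> \<noteq> 0"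
  shows "of_real (poly (pderiv Q) \<tau>) =
    - of_real (poly Q \<tau>) * trace (curvature_form D c e z ** matrix_inv (base_metric D \<tau> c e z))"
proof -
  let ?G = "base_metric D \<tau> c e z" and ?\<gamma> = "curvature_form D c e z" and ?g = "metric D c z"
  have nz': "det ?G \<noteq> 0" using nz det_metric_nonzero[OF z] by (simp add: det_base_metric[OF z])
  have G: "(\<chi> i j. ?G $ i $ j + of_real s * (- ?\<gamma>) $ i $ j) = base_metric D (\<tau> + s) c e z" for s :: real
    by (simp add: vec_eq_iff base_metric_def scaleR_conv_of_real[where 'a = complex] algebra_simps)
  have "((\<lambda>s. det (\<chi> i j. ?G $ i $ j + of_real s * (- ?\<gamma>) $ i $ j)) has_vector_derivative
      det_derivative ?G (- ?\<gamma>)) (at 0)"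
    using has_field_derivative_det[of ?G "- ?\<gamma>"] by (intro has_vector_derivative_real_field) simp
  then have "((\<lambda>s. of_real (poly Q (\<tau> + s)) * det ?g) has_vector_derivative det_derivative ?G (- ?\<gamma>)) (at 0)"
    unfolding G det_base_metric[OF z] .
  moreover have "((\<lambda>s. of_real (poly Q (\<tau> + s)) * det ?g) has_vector_derivative
      of_real (poly (pderiv Q) \<tau>) * det ?g) (at 0)"
  proof -
    have "((\<lambda>s. poly Q (\<tau> + s)) has_real_derivative poly (pderiv Q) \<tau>) (at 0)"
      using DERIV_shift[of "poly Q" "poly (pderiv Q) \<tau>" 0 \<tau>] poly_DERIV[of Q \<tau>]
      by (simp add: add.commute)
    then show ?thesis
      by (intro has_vector_derivative_mult_left has_vector_derivative_of_real)
  qed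
  ultimately have "of_real (poly (pderiv Q) \<tau>) * det ?g = det_derivative ?G (- ?\<gamma>)"
    by (rule vector_derivative_unique_at[rotated])
  also have "\<dots> = det ?G * trace ((- ?\<gamma>) ** matrix_inv ?G)" by (rule det_derivative_eq_trace[OF nz'])
  also have "trace ((- ?\<gamma>) ** matrix_inv ?G) = - trace (?\<gamma> ** matrix_inv ?G)"
    using trace_add_scaled[of 0 "-1" ?\<gamma> "matrix_inv ?G"] by (simp add: trace_def)
  finally have "of_real (poly (pderiv Q) \<tau>) * det ?g =
      (- of_real (poly Q \<tau>) * trace (?\<gamma> ** matrix_inv ?G)) * det ?g"
    by (simp add: det_base_metric[OF z] mult_ac)
  then show ?thesis by (rule iffD1[OF mult_right_cancel[OF det_metric_nonzero[OF z]]])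
qed

end

section \<open>Geometry of the total space\<close>

text \<open>Below, \<open>T\<close> is always the vector \<open>\<partial>t\<close> of holomorphic derivatives of \<open>t\<close>.\<close>

definition frame :: "('m::finite option \<Rightarrow> complex) \<Rightarrow> complex^('m option)^('m option)" where
  "frame T = (\<chi> i j. case j of None \<Rightarrow> T i | Some b \<Rightarrow> if i = Some b then 1 else 0)"

text \<open>The conjugate transpose \<open>N\<^sup>*\<close>: the remaining entries of
  \<open>frame\<close> are 0 and 1, so conjugating \<open>T\<close> is enough.\<close>

definition coframe :: "('m::finite option \<Rightarrow> complex) \<Rightarrow> complex^('m option)^('m option)" where
  "coframe T = transpose (frame (\<lambda>i. cnj (T i)))"

lemma frame_nth [simp]:
  "frame T $ i $ None = T i" "frame T $ i $ Some b = (if i = Some b then 1 else 0)"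
  "coframe T $ None $ i = cnj (T i)" "coframe T $ Some b $ i = (if i = Some b then 1 else 0)"
  by (simp_all add: coframe_def transpose_def frame_def)

lemma det_frame: "det (frame (T :: 'm::finite option \<Rightarrow> complex)) = T None"
proof -
  have "(\<chi> i j. frame T $ Some i $ Some j) = mat 1"
    by (simp add: vec_eq_iff mat_def)
  then show ?thesis using det_first_row[of "frame T"] by simp
qed

lemma det_coframe: "det (coframe (T :: 'm::finite option \<Rightarrow> complex)) = cnj (T None)"
  by (simp add: coframe_def det_frame)

text \<open>A form from the base plus a rank-one term in \<open>T\<close> is a congruence of a block
  diagonal matrix. Determinants and traces then follow at every point, with no need for a
  trivialisation in which the derivative of \<open>h\<close> vanishes there.\<close>

lemma frame_conjugate:
  fixes T :: "'m::finite option \<Rightarrow> complex"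
  shows "(frame T ** block x A ** coframe T) $ i $ j = block 0 A $ i $ j + x * T i * cnj (T j)"
proof -
  have 1: "(frame T ** block x A) $ i $ None = T i * x" for i
    by (simp add: matrix_matrix_mult_def sum_UNIV_option)
  have 2: "(frame T ** block x A) $ i $ Some b = block 0 A $ i $ Some b" for i b
    by (cases i) (simp_all add: matrix_matrix_mult_def sum_UNIV_option
        if_distrib[of "\<lambda>x. x * _"] cong: if_cong)
  have 3: "block 0 A $ i $ None = 0" for i
    by (cases i) simp_all
  show ?thesis
    by (cases j) (simp_all add: matrix_matrix_mult_def[of "frame T ** block x A"] sum_UNIV_option 1 2 3
        if_distrib[of "\<lambda>x. _ * x"] cong: if_cong)
qed

lemma pullback_base_part:
  fixes F :: "complex^('m::finite option) \<Rightarrow> complex^'m"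
  assumes S: "open S" and w: "w \<in> S" and F: "\<And>v. v \<in> S \<Longrightarrow> F v = base_part v"
  shows "pullback F a w = block 0 (a (base_part w))"
proof -
  have "((\<lambda>v. v $ Some k) has_derivative (\<lambda>v. v $ Some k)) (at w)" for k :: 'm
    by (intro bounded_linear_imp_has_derivative bounded_linear_vec_nth)
  note * = del_eq[OF this]
  have "del i (\<lambda>v. v $ Some k) w = (if i = Some k then 1 else 0)" for i k
    unfolding * by (simp add: axis_def)
  moreover have "del i (\<lambda>v. F v $ k) w = del i (\<lambda>v. v $ Some k) w" for i k
    by (rule del_cong_open[OF S w]) (simp add: F base_part_def)
  ultimately have *: "del i (\<lambda>v. F v $ k) w = (if i = Some k then 1 else 0)" for i k by simp
  show ?thesis
    by (rule matrix_option_eqI)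
      (simp_all add: pullback_def * F[OF w] if_distrib[of cnj] if_distrib[of "\<lambda>x. x * _"]
        if_distrib[of "\<lambda>x. _ * x"] cong: if_cong)
qed

lemma DERIV_half: "((\<lambda>x. x / 2) has_real_derivative (\<lambda>x. 1 / 2) x) (at x)"
  "((\<lambda>x. 1 / 2) has_real_derivative 0) (at x)"
  by (auto intro!: derivative_eq_intros)

context horizontal_patch
begin

abbreviation "\<beta> \<equiv> bundle_chart D c e"

lemma bundle_chart_nth:
  "snd \<beta> y $ None = snd e y" "base_part (snd \<beta> y) = snd c (proj D y)"
  by (simp_all add: bundle_chart_def base_part_def)

lemma bundle_chart_domain:
  "y \<in> fst \<beta> \<longleftrightarrow> y \<in> topspace (total D) \<and> proj D y \<in> fst c \<and> proj D y \<in> fst e"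
  by (auto simp: bundle_chart_def bundle_over_def)

lemma bundle_chart_patch: "y \<in> fst \<beta> \<Longrightarrow> base_part (snd \<beta> y) \<in> patch c e"
  by (auto simp: bundle_chart_nth bundle_chart_domain patch_def)

text \<open>The trivialisation maps onto \<open>fst e\<close> times all of the complex plane, so
  over the patch every value of the fibre coordinate occurs.\<close>

lemma bundle_chart_inv:
  assumes w: "base_part w \<in> patch c e"
  shows "chart_inv \<beta> w \<in> fst \<beta>" "snd \<beta> (chart_inv \<beta> w) = w"
proof -
  let ?x = "chart_inv c (base_part w)"
  note x = chart_inv_patch[OF w]
  have "(?x, w $ None) \<in> topspace (prod_topology (subtopology (base D) (fst e)) euclidean)"
    using x(1) openin_subset[OF triv_props(1)] by auto
  then obtain y where y: "y \<in> topspace (subtopology (total D) (bundle_over D (fst e)))"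
    "(?x, w $ None) = (proj D y, snd e y)"
    unfolding homeomorphic_imp_surjective_map[OF triv_props(2), symmetric] by blast
  have "y \<in> fst \<beta>" using y x(1) by (auto simp: bundle_chart_domain)
  moreover have "snd \<beta> y = w"
  proof -
    have "snd \<beta> y $ k = w $ k" for k
    proof (cases k)
      case None then show ?thesis using y(2) by (simp add: bundle_chart_nth)
    next
      case (Some i)
      have "base_part (snd \<beta> y) = base_part w" using y(2) x(2) by (simp add: bundle_chart_nth)
      then have "base_part (snd \<beta> y) $ i = base_part w $ i" by simp
      then show ?thesis by (simp only: Some base_part_def vec_lambda_beta)
    qed
    then show ?thesis by (simp add: vec_eq_iff)
  qed
  ultimately have "w \<in> snd \<beta> ` fst \<beta>" by blast
  then show "chart_inv \<beta> w \<in> fst \<beta>" "snd \<beta> (chart_inv \<beta> w) = w"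
    by (rule inv_into_into, rule f_inv_into_f)
qed

lemma normsq_eq:
  assumes y: "y \<in> fst \<beta>"
  shows "normsq D y = (cmod (snd \<beta> y $ None))\<^sup>2 * h (base_part (snd \<beta> y))"
proof -
  have "y \<in> bundle_over D (fst e)" "proj D y \<in> fst c"
    using y by (auto simp: bundle_chart_domain bundle_over_def)
  then show ?thesis
    using hermitian_structure_e(1)[of y] chart_inj by (simp add: bundle_chart_nth h_def)
qed

section \<open>The logarithm \<open>t\<close> of the norm in a bundle chart\<close>

definition punctured :: "(complex^('m option)) set" where
  "punctured = {w. base_part w \<in> patch c e \<and> w $ None \<noteq> 0}"

definition logn :: "complex^('m option) \<Rightarrow> real" where
  "logn w = (ln ((cmod (w $ None))\<^sup>2) + ln (h (base_part w))) / 2"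

lemma log_norm_eq:
  assumes "y \<in> fst \<beta>" "snd \<beta> y $ None \<noteq> 0"
  shows "log_norm D y = logn (snd \<beta> y)"
  using h_pos[OF bundle_chart_patch[OF assms(1)]] assms(2)
  by (simp add: log_norm_def logn_def normsq_eq[OF assms(1)] ln_mult_pos)

lemma open_punctured: "open punctured"
proof -
  have "punctured = {w. base_part w \<in> patch c e} \<inter> {w. w $ None \<noteq> 0}" by (auto simp: punctured_def)
  then show ?thesis using open_base_part_vimage[OF open_patch] open_fibre_nonzero by auto
qed

lemma c2_ln_cmod: "c2_on punctured (\<lambda>w. ln ((cmod (w $ None))\<^sup>2))"
  by (rule c2_on_subset[OF c2_on_ln_cmod_sq]) (auto simp: punctured_def)

lemma c2_pulled_back: "c2_on (patch c e) v \<Longrightarrow> c2_on punctured (\<lambda>w. v (base_part w))"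
  by (rule c2_on_base_part[OF _ open_patch open_punctured]) (auto simp: punctured_def)

lemma c2_sum_logs: "c2_on punctured (\<lambda>w. ln ((cmod (w $ None))\<^sup>2) + ln (h (base_part w)))"
  by (rule c2_on_add[OF c2_ln_cmod c2_pulled_back[OF c2_ln_h] open_punctured])

lemma c2_logn: "c2_on punctured logn"
  unfolding logn_def[abs_def]
  by (rule c2_on_real_compose[OF c2_sum_logs open_punctured DERIV_half(1) DERIV_half(2)])

text \<open>The term \<open>log |z\<^sup>0|\<^sup>2\<close> is pluriharmonic, and half of
  \<open>log h\<close> leaves half of \<open>-\<gamma>\<close>.\<close>

lemma i_ddbar_logn:
  assumes w: "w \<in> punctured"
  shows "i_ddbar (\<lambda>w. complex_of_real (logn w)) w = block 0 (- (1 / 2) *\<^sub>R curvature_form D c e (base_part w))"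
proof -
  have w': "base_part w \<in> patch c e" "w $ None \<noteq> 0" using w by (auto simp: punctured_def)
  let ?l = "\<lambda>w :: complex^('m option). ln ((cmod (w $ None))\<^sup>2)"
  have "i_ddbar (\<lambda>w. complex_of_real (?l w + ln (h (base_part w)))) w =
      i_ddbar (\<lambda>w. complex_of_real (?l w)) w + i_ddbar (\<lambda>w. complex_of_real (ln (h (base_part w)))) w"
    unfolding of_real_add
    by (rule i_ddbar_add[OF c2_on_of_real[OF c2_ln_cmod open_punctured]
          c2_on_of_real[OF c2_pulled_back[OF c2_ln_h] open_punctured] open_punctured w])
  also have "i_ddbar (\<lambda>w. complex_of_real (?l w)) w = 0" by (rule i_ddbar_ln_cmod_sq[OF w'(2)])
  also have "i_ddbar (\<lambda>w. complex_of_real (ln (h (base_part w)))) w =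
      block 0 (- curvature_form D c e (base_part w))"
    using i_ddbar_base_part[OF c2_on_of_real[OF c2_ln_h open_patch] open_patch w'(1)]
    by (simp add: curvature_form_eq)
  finally have *: "i_ddbar (\<lambda>w. complex_of_real (?l w + ln (h (base_part w)))) w =
      block 0 (- curvature_form D c e (base_part w))" by simp
  have **: "i_ddbar (\<lambda>w. complex_of_real (logn w)) w $ i $ j =
      of_real (1 / 2) * block 0 (- curvature_form D c e (base_part w)) $ i $ j" for i j
    using i_ddbar_real_compose[OF c2_sum_logs open_punctured w DERIV_half(1) DERIV_half(2), of i j]
    unfolding * logn_def by simp
  show ?thesis
    by (rule matrix_option_eqI) (simp_all add: ** scaleR_conv_of_real[where 'a = complex])
qed

text \<open>The one component of \<open>\<partial>t\<close> whose value matters: it is the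
  determinant of the frame. The others are carried along unevaluated.\<close>

lemma del_logn_None:
  assumes w: "w \<in> punctured"
  shows "del None (\<lambda>w. complex_of_real (logn w)) w = 1 / (2 * w $ None)"
proof -
  have w': "base_part w \<in> patch c e" "w $ None \<noteq> 0" using w by (auto simp: punctured_def)
  let ?l = "\<lambda>w :: complex^('m option). complex_of_real (ln ((cmod (w $ None))\<^sup>2))"
    and ?v = "\<lambda>z. complex_of_real (ln (h z))"
  have v: "c2_on (patch c e) ?v" by (rule c2_on_of_real[OF c2_ln_h open_patch])
  have "del None (\<lambda>w. complex_of_real (ln ((cmod (w $ None))\<^sup>2) + ln (h (base_part w)))) w =
      del None ?l w + del None (\<lambda>w. ?v (base_part w)) w"
    unfolding of_real_add
    by (rule del_add(1)[OF c2_on_differentiable[OF c2_on_of_real[OF c2_ln_cmod open_punctured] w]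
          c2_on_differentiable[OF c2_pulled_back[OF v] w]])
  also have "\<dots> = 1 / w $ None"
    by (simp add: del_ln_cmod_sq[OF w'(2)] del_base_part(3)[OF c2_on_differentiable[OF v w'(1)]])
  finally show ?thesis
    using del_real_compose(1)[OF c2_on_differentiable[OF c2_sum_logs w] DERIV_half(1), of None]
    by (simp add: logn_def)
qed

end

locale momentum_patch =
  constant_volume_patch D I c e Q + momentum_construction I \<phi> \<tau>\<^sub>0
  for D :: "('a, 'b, 'm::finite) line_bundle_data" and I :: "real set"
    and c :: "('a, 'm) chart" and e :: "'a set \<times> ('b \<Rightarrow> complex)" and Q :: "real poly"
    and \<phi> :: "real \<Rightarrow> real" and \<tau>\<^sub>0 :: real +
  fixes \<phi>\<^sub>1 \<phi>\<^sub>2 :: "real \<Rightarrow> real"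
  assumes \<phi>\<^sub>1: "x \<in> interior I \<Longrightarrow> (\<phi> has_real_derivative \<phi>\<^sub>1 x) (at x)"
    and \<phi>\<^sub>2: "x \<in> interior I \<Longrightarrow> (\<phi>\<^sub>1 has_real_derivative \<phi>\<^sub>2 x) (at x)"
begin

abbreviation "\<mu> \<equiv> momentum I \<phi> \<tau>\<^sub>0"

section \<open>The bundle-adapted metric and its Ricci form over the momentum domain\<close>

definition region :: "(complex^('m option)) set" where
  "region = {w \<in> punctured. logn w \<in> times}"

lemma region_punctured: "w \<in> region \<Longrightarrow> w \<in> punctured"
  by (simp add: region_def)

lemma open_region: "open region"
proof -
  have "continuous_on punctured logn"
    using c2_on_differentiable[OF c2_logn] differentiable_imp_continuous_within
    by (metis continuous_at_imp_continuous_on)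
  from continuous_open_preimage[OF this open_punctured open_times]
  have "open (punctured \<inter> logn -` times)" .
  moreover have "punctured \<inter> logn -` times = region" by (auto simp: region_def)
  ultimately show ?thesis by simp
qed

lemma c2_logn_region: "c2_on region logn"
  by (rule c2_on_subset[OF c2_logn]) (auto simp: region_def)

lemma region_props:
  assumes "w \<in> region"
  shows "base_part w \<in> patch c e" "w $ None \<noteq> 0" "logn w \<in> times" "\<mu> (logn w) \<in> interior I" "\<mu> (logn w) \<in> I"
  using assms momentum_in(1)[of "logn w"] interior_subset
  by (auto simp: region_def punctured_def)

text \<open>In \<open>2 \<i> \<partial>\<partial>bar f(t)\<close> the first derivative contributes
  \<open>2 \<tau> (-\<gamma>/2)\<close>, which turns \<open>\<omega>\<^sub>M\<close> into
  \<open>\<omega>\<^sub>M(\<tau>)\<close>; the second derivative \<open>\<phi>(\<tau>)\<close>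
  carries two factors 2 and becomes the fibre entry.\<close>

lemma bundle_metric_eq:
  assumes w: "w \<in> region"
  shows "bundle_metric D I \<phi> \<tau>\<^sub>0 c e w =
    frame (\<lambda>k. del k (\<lambda>w. complex_of_real (logn w)) w) **
    block (4 * of_real (\<phi> (\<mu> (logn w)))) (base_metric D (\<mu> (logn w)) c e (base_part w)) **
    coframe (\<lambda>k. del k (\<lambda>w. complex_of_real (logn w)) w)" (is "_ = frame ?T ** _ ** _")
proof -
  let ?f = "potential I \<phi> \<tau>\<^sub>0" and ?z = "base_part w" and ?\<tau> = "\<mu> (logn w)"
  note pr = region_props
  have "pullback (snd c \<circ> proj D \<circ> chart_inv \<beta>) (metric D c) w = block 0 (metric D c ?z)"
  proof (rule pullback_base_part[OF open_region w])
    fix v assume "v \<in> region"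
    then have "snd \<beta> (chart_inv \<beta> v) = v" using bundle_chart_inv(2) pr(1) by blast
    then show "(snd c \<circ> proj D \<circ> chart_inv \<beta>) v = base_part v"
      using bundle_chart_nth(2)[of "chart_inv \<beta> v"] by simp
  qed
  moreover have "i_ddbar (\<lambda>v. complex_of_real (?f (log_norm D (chart_inv \<beta> v)))) w =
      i_ddbar (\<lambda>v. complex_of_real (?f (logn v))) w"
  proof (rule i_ddbar_cong_open[OF open_region w])
    fix v assume v: "v \<in> region"
    then have "chart_inv \<beta> v \<in> fst \<beta>" "snd \<beta> (chart_inv \<beta> v) = v" using bundle_chart_inv pr(1) by blast+
    then show "complex_of_real (?f (log_norm D (chart_inv \<beta> v))) = complex_of_real (?f (logn v))"
      using log_norm_eq[of "chart_inv \<beta> v"] pr(2)[OF v] by simp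
  qed
  ultimately have "bundle_metric D I \<phi> \<tau>\<^sub>0 c e w =
      block 0 (metric D c ?z) + 2 *\<^sub>R i_ddbar (\<lambda>v. complex_of_real (?f (logn v))) w"
    by (simp add: bundle_metric_def)
  moreover have "i_ddbar (\<lambda>v. complex_of_real (?f (logn v))) w $ i $ j =
      of_real ?\<tau> * block 0 (- (1 / 2) *\<^sub>R curvature_form D c e ?z) $ i $ j +
      2 * of_real (\<phi> ?\<tau>) * ?T i * cnj (?T j)" for i j
    using i_ddbar_real_compose[OF c2_logn_region open_region w potential_derivative[OF pr(3)]
        momentum_derivative[OF pr(3)[OF w]], of i j]
    unfolding i_ddbar_logn[OF region_punctured[OF w]] .
  ultimately have "bundle_metric D I \<phi> \<tau>\<^sub>0 c e w $ i $ j =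
      block 0 (base_metric D ?\<tau> c e ?z) $ i $ j + 4 * of_real (\<phi> ?\<tau>) * ?T i * cnj (?T j)" for i j
    by (cases i; cases j)
      (simp_all add: base_metric_def scaleR_conv_of_real[where 'a = complex] algebra_simps)
  then show ?thesis by (simp only: vec_eq_iff frame_conjugate) simp
qed

text \<open>The frame and its conjugate contribute \<open>1 / (4 |z\<^sup>0|\<^sup>2)\<close>, which
  cancels the 4 of the fibre entry.\<close>

lemma det_bundle_metric:
  assumes w: "w \<in> region"
  shows "Re (det (bundle_metric D I \<phi> \<tau>\<^sub>0 c e w)) =
    poly Q (\<mu> (logn w)) * \<phi> (\<mu> (logn w)) * Re (det (metric D c (base_part w))) / (cmod (w $ None))\<^sup>2"
proof -
  let ?\<tau> = "\<mu> (logn w)" and ?z = "w $ None"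
  have "det (bundle_metric D I \<phi> \<tau>\<^sub>0 c e w) = 1 / (2 * ?z) * (4 * of_real (\<phi> ?\<tau>) *
      (of_real (poly Q ?\<tau>) * det (metric D c (base_part w)))) * cnj (1 / (2 * ?z))"
    by (simp add: bundle_metric_eq[OF w] det_mul det_frame det_coframe det_block
        del_logn_None[OF region_punctured[OF w]] det_base_metric[OF region_props(1)[OF w]])
  also have "\<dots> = of_real (poly Q ?\<tau> * \<phi> ?\<tau>) * det (metric D c (base_part w)) / (?z * cnj ?z)"
    using region_props(2)[OF w] by (simp add: field_simps)
  also have "?z * cnj ?z = of_real ((cmod ?z)\<^sup>2)" using complex_norm_square[of ?z] by simp
  finally show ?thesis by simp
qed

text \<open>The point \<open>w\<close> serves as a witness that the patch is inhabited; positivity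
  is inherited from the metric \<open>g\<^sub>M(x)\<close> there.\<close>

lemma Q_pos_region: "w \<in> region \<Longrightarrow> x \<in> interior I \<Longrightarrow> 0 < poly Q x"
  using Q_pos region_props(1) interior_subset by blast

text \<open>\<open>(Q\<phi>)'\<close> and, in the next line, \<open>(Q\<phi>)''\<close>, expanded by
  the Leibniz rule.\<close>

definition "R\<^sub>1 x = poly (pderiv Q) x * \<phi> x + poly Q x * \<phi>\<^sub>1 x"
definition "R\<^sub>2 x = poly (pderiv (pderiv Q)) x * \<phi> x + 2 * poly (pderiv Q) x * \<phi>\<^sub>1 x + poly Q x * \<phi>\<^sub>2 x"

lemma R_derivative:
  assumes "x \<in> interior I"
  shows "((\<lambda>s. poly Q s * \<phi> s) has_real_derivative R\<^sub>1 x) (at x)"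
    "(R\<^sub>1 has_real_derivative R\<^sub>2 x) (at x)"
  unfolding R\<^sub>1_def[abs_def] R\<^sub>2_def
  by (auto intro!: derivative_eq_intros \<phi>\<^sub>1 \<phi>\<^sub>2 assms simp: algebra_simps)

text \<open>The inner \<open>deriv\<close> is known to be \<open>R\<^sub>1\<close> only on the
  interior of \<open>I\<close>, which is open and therefore enough for the outer derivative.\<close>

lemma deriv2_eq:
  assumes x: "x \<in> interior I"
  shows "deriv (deriv (\<lambda>s. poly Q s * \<phi> s)) x = R\<^sub>2 x"
proof (rule DERIV_imp_deriv)
  show "(deriv (\<lambda>s. poly Q s * \<phi> s) has_real_derivative R\<^sub>2 x) (at x)"
    by (rule has_field_derivative_transform_within_open[OF R_derivative(2)[OF x] open_interior x])
      (rule DERIV_imp_deriv[OF R_derivative(1), symmetric])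
qed

text \<open>The function \<open>u\<close> of the overview and its derivatives in \<open>t\<close>.
  Each differentiation multiplies the \<tau>-derivative by \<phi>; in
  \<open>u' = \<phi> (Q\<phi>)' / (Q\<phi>)\<close> this factor cancels and leaves
  \<open>(Q\<phi>)' / Q\<close>.\<close>

definition "L t = ln (poly Q (\<mu> t) * \<phi> (\<mu> t))"
definition "L\<^sub>1 t = R\<^sub>1 (\<mu> t) / poly Q (\<mu> t)"
definition "L\<^sub>2 t = \<phi> (\<mu> t) * (R\<^sub>2 (\<mu> t) / poly Q (\<mu> t) -
  R\<^sub>1 (\<mu> t) * poly (pderiv Q) (\<mu> t) / (poly Q (\<mu> t))\<^sup>2)"

lemma L_derivative:
  assumes w: "w \<in> region" and t: "t \<in> times"
  shows "(L has_real_derivative L\<^sub>1 t) (at t)" "(L\<^sub>1 has_real_derivative L\<^sub>2 t) (at t)"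
proof -
  have x: "\<mu> t \<in> interior I" by (rule momentum_in(1)[OF t])
  have p: "0 < poly Q (\<mu> t)" "0 < \<phi> (\<mu> t)" using Q_pos_region[OF w x] pos[OF x] by auto
  have "((\<lambda>x. ln (poly Q x * \<phi> x)) has_real_derivative R\<^sub>1 (\<mu> t) / (poly Q (\<mu> t) * \<phi> (\<mu> t))) (at (\<mu> t))"
    using DERIV_chain2[OF DERIV_ln[OF mult_pos_pos[OF p]] R_derivative(1)[OF x]]
    by (simp add: divide_inverse mult.commute)
  from DERIV_chain2[OF this momentum_derivative[OF t]]
  show "(L has_real_derivative L\<^sub>1 t) (at t)" using p by (simp add: L_def[abs_def] L\<^sub>1_def)
  have "((\<lambda>x. R\<^sub>1 x / poly Q x) has_real_derivative
      (R\<^sub>2 (\<mu> t) / poly Q (\<mu> t) - R\<^sub>1 (\<mu> t) * poly (pderiv Q) (\<mu> t) / (poly Q (\<mu> t))\<^sup>2)) (at (\<mu> t))"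
    using p by (auto intro!: derivative_eq_intros R_derivative(2)[OF x] simp: field_simps power2_eq_square)
  from DERIV_chain2[OF this momentum_derivative[OF t]]
  show "(L\<^sub>1 has_real_derivative L\<^sub>2 t) (at t)" by (simp add: L\<^sub>1_def[abs_def] L\<^sub>2_def mult.commute)
qed

text \<open>The logarithm of the determinant is \<open>u(t)\<close> plus the logarithm from the base
  minus \<open>log |z\<^sup>0|\<^sup>2\<close>. The last term drops out, and the chain rule for
  \<open>u(t)\<close> produces the curvature term and the fibre entry, with the sign of the Ricci
  form.\<close>

lemma ricci_bundle_metric:
  assumes w: "w \<in> region"
  shows "ricci_form (bundle_metric D I \<phi> \<tau>\<^sub>0 c e) w =
    frame (\<lambda>k. del k (\<lambda>w. complex_of_real (logn w)) w) **
    block (- 2 * of_real (L\<^sub>2 (logn w)))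
      (ricci_form (metric D c) (base_part w) + (L\<^sub>1 (logn w) / 2) *\<^sub>R curvature_form D c e (base_part w)) **
    coframe (\<lambda>k. del k (\<lambda>w. complex_of_real (logn w)) w)" (is "_ = frame ?T ** _ ** _")
proof -
  let ?z = "base_part w"
  let ?l = "\<lambda>w :: complex^('m option). ln ((cmod (w $ None))\<^sup>2)"
    and ?v = "\<lambda>z. ln (Re (det (metric D c z)))"
  have split: "ln (Re (det (bundle_metric D I \<phi> \<tau>\<^sub>0 c e v))) = L (logn v) + (?v (base_part v) + - ?l v)"
    if v: "v \<in> region" for v
  proof -
    note pr = region_props[OF v]
    have "0 < poly Q (\<mu> (logn v)) * \<phi> (\<mu> (logn v))" "0 < Re (det (metric D c (base_part v)))"
      "0 < (cmod (v $ None))\<^sup>2"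
      using Q_pos_region[OF v pr(4)] pos[OF pr(4)] pr(2) positive_herm_det_pos[OF metric_positive[OF pr(1)]] by auto
    moreover have "ln (a * b / c) = ln a + (ln b + - ln c)" if "0 < a" "0 < b" "0 < c" for a b c :: real
      using that by (simp add: ln_div ln_mult_pos)
    ultimately show ?thesis by (simp only: det_bundle_metric[OF v] L_def)
  qed
  have neg: "(uminus has_real_derivative (\<lambda>x. -1) x) (at x)" "((\<lambda>x. -1) has_real_derivative 0) (at x)" for x :: real
    by (auto intro!: derivative_eq_intros)
  have sub: "region \<subseteq> punctured" by (auto simp: region_def)
  have l: "c2_on region ?l" by (rule c2_on_subset[OF c2_ln_cmod sub])
  have v: "c2_on region (\<lambda>w. ?v (base_part w))" by (rule c2_on_subset[OF c2_pulled_back[OF c2_ln_det] sub])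
  have nl: "c2_on region (\<lambda>w. - ?l w)" by (rule c2_on_real_compose[OF l open_region neg])
  have Lt: "c2_on region (\<lambda>w. L (logn w))"
    by (rule c2_on_real_compose[OF c2_logn_region open_region L_derivative(1)[OF w] L_derivative(2)[OF w]])
      (rule region_props(3), assumption)+
  have "i_ddbar (\<lambda>v. complex_of_real (ln (Re (det (bundle_metric D I \<phi> \<tau>\<^sub>0 c e v))))) w =
      i_ddbar (\<lambda>v. complex_of_real (L (logn v)) + (complex_of_real (?v (base_part v)) + complex_of_real (- ?l v))) w"
    by (rule i_ddbar_cong_open[OF open_region w]) (simp add: split)
  also have "\<dots> = i_ddbar (\<lambda>v. complex_of_real (L (logn v))) w +
      (i_ddbar (\<lambda>v. complex_of_real (?v (base_part v))) w + i_ddbar (\<lambda>v. complex_of_real (- ?l v)) w)"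
    by (simp only: i_ddbar_add[OF c2_on_of_real[OF Lt open_region]
          c2_on_add[OF c2_on_of_real[OF v open_region] c2_on_of_real[OF nl open_region] open_region] open_region w]
        i_ddbar_add[OF c2_on_of_real[OF v open_region] c2_on_of_real[OF nl open_region] open_region w])
  also have "i_ddbar (\<lambda>v. complex_of_real (- ?l v)) w = 0"
  proof -
    have "i_ddbar (\<lambda>v. complex_of_real (- ?l v)) w $ i $ j = 0" for i j
      using i_ddbar_real_compose[OF l open_region w neg, of i j]
      by (simp add: i_ddbar_ln_cmod_sq[OF region_props(2)[OF w]])
    then show ?thesis by (simp add: vec_eq_iff)
  qed
  also have "i_ddbar (\<lambda>v. complex_of_real (?v (base_part v))) w = block 0 (- ricci_form (metric D c) ?z)"
    using i_ddbar_base_part[OF c2_on_of_real[OF c2_ln_det open_patch] open_patch region_props(1)[OF w]]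
    by (simp add: ricci_form_def)
  finally have r: "ricci_form (bundle_metric D I \<phi> \<tau>\<^sub>0 c e) w =
      - (i_ddbar (\<lambda>v. complex_of_real (L (logn v))) w + block 0 (- ricci_form (metric D c) ?z))"
    by (simp add: ricci_form_def)
  have "i_ddbar (\<lambda>v. complex_of_real (L (logn v))) w $ i $ j =
      of_real (L\<^sub>1 (logn w)) * block 0 (- (1 / 2) *\<^sub>R curvature_form D c e ?z) $ i $ j +
      2 * of_real (L\<^sub>2 (logn w)) * ?T i * cnj (?T j)" for i j
    using i_ddbar_real_compose[OF c2_logn_region open_region w L_derivative(1)[OF w region_props(3)]
        L_derivative(2)[OF w region_props(3)[OF w]], of i j]
    unfolding i_ddbar_logn[OF region_punctured[OF w]] .
  then have "ricci_form (bundle_metric D I \<phi> \<tau>\<^sub>0 c e) w $ i $ j =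
      block 0 (ricci_form (metric D c) ?z + (L\<^sub>1 (logn w) / 2) *\<^sub>R curvature_form D c e ?z) $ i $ j +
      (- 2 * of_real (L\<^sub>2 (logn w))) * ?T i * cnj (?T j)" for i j
    unfolding r
    by (cases i; cases j) (simp_all add: scaleR_conv_of_real[where 'a = complex] algebra_simps)
  then show ?thesis by (simp only: vec_eq_iff frame_conjugate) simp
qed

lemma scalar_curvature_bundle_metric:
  assumes w: "w \<in> region"
  defines "\<tau> \<equiv> \<mu> (logn w)"
  assumes s: "scalar_curvature (base_metric D \<tau> c e) (base_part w) = of_real (p / (2 * poly Q \<tau>))"
  shows "scalar_curvature (bundle_metric D I \<phi> \<tau>\<^sub>0 c e) w =
    of_real ((p - deriv (deriv (\<lambda>s. poly Q s * \<phi> s)) \<tau>) / (2 * poly Q \<tau>))"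
proof -
  let ?z = "base_part w" and ?T = "\<lambda>k. del k (\<lambda>w. complex_of_real (logn w)) w"
  let ?G = "base_metric D \<tau> c e ?z" and ?\<gamma> = "curvature_form D c e ?z" and ?\<rho> = "ricci_form (metric D c) ?z"
  note pr = region_props[OF w, folded \<tau>_def]
  have q: "0 < poly Q \<tau>" by (rule Q_pos_region[OF w pr(4)])
  have \<phi>: "0 < \<phi> \<tau>" by (rule pos[OF pr(4)])
  have G: "det ?G \<noteq> 0" by (rule positive_herm_det_nonzero[OF base_metric_positive[OF pr(5,1)]])
  have T: "?T None \<noteq> 0" using pr(2) by (simp add: del_logn_None[OF region_punctured[OF w]])
  have "scalar_curvature (bundle_metric D I \<phi> \<tau>\<^sub>0 c e) w =
      trace (block (- 2 * of_real (L\<^sub>2 (logn w))) (?\<rho> + (L\<^sub>1 (logn w) / 2) *\<^sub>R ?\<gamma>) **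
        matrix_inv (block (4 * of_real (\<phi> \<tau>)) ?G))"
    unfolding scalar_curvature_eq ricci_bundle_metric[OF w] bundle_metric_eq[OF w] \<tau>_def[symmetric]
    by (rule trace_conjugate) (use T G \<phi> in \<open>simp_all add: det_frame det_coframe det_block\<close>)
  also have "\<dots> = - 2 * of_real (L\<^sub>2 (logn w)) / (4 * of_real (\<phi> \<tau>)) +
      (trace (?\<rho> ** matrix_inv ?G) + of_real (L\<^sub>1 (logn w) / 2) * trace (?\<gamma> ** matrix_inv ?G))"
    using \<phi> G by (simp add: matrix_inv_block block_mult trace_block trace_add_scaled)
  also have "trace (?\<rho> ** matrix_inv ?G) = of_real (p / (2 * poly Q \<tau>))"
    using s scalar_curvature_base_metric[OF pr(5,1)] by simp
  also have "trace (?\<gamma> ** matrix_inv ?G) = of_real (- poly (pderiv Q) \<tau> / poly Q \<tau>)"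
    using Q_derivative[OF pr(1), of \<tau>] q by (simp add: field_simps)
  finally have "scalar_curvature (bundle_metric D I \<phi> \<tau>\<^sub>0 c e) w =
      of_real (- 2 * L\<^sub>2 (logn w) / (4 * \<phi> \<tau>) +
        (p / (2 * poly Q \<tau>) + L\<^sub>1 (logn w) / 2 * (- poly (pderiv Q) \<tau> / poly Q \<tau>)))"
    by simp
  \<comment> \<open>The \<open>u''\<close> term equals
    \<open>-R\<^sub>2 / (2Q) + R\<^sub>1 Q' / (2Q\<^sup>2)\<close>, and the trace of \<gamma>
    contributes \<open>-R\<^sub>1 Q' / (2Q\<^sup>2)\<close>; the first-order terms cancel and only
    \<open>(Q\<phi>)''\<close> remains.\<close>
  also have "- 2 * L\<^sub>2 (logn w) / (4 * \<phi> \<tau>) +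
        (p / (2 * poly Q \<tau>) + L\<^sub>1 (logn w) / 2 * (- poly (pderiv Q) \<tau> / poly Q \<tau>)) =
      (p - R\<^sub>2 \<tau>) / (2 * poly Q \<tau>)"
    using \<phi> q unfolding L\<^sub>1_def L\<^sub>2_def \<tau>_def[symmetric]
    by (simp add: field_simps power2_eq_square)
  finally show ?thesis by (simp only: deriv2_eq[OF pr(4)])
qed

end

theorem corollary1p1:
  fixes D :: "('a, 'b, 'm::finite) line_bundle_data" and I :: "real set"
  assumes "horizontal_data D I"
    and "sigma_constant D I"
  shows "\<exists>(Q :: real \<Rightarrow> real) (P :: real poly).
    (\<forall>\<tau>. \<forall>c\<in>atlas D. \<forall>e\<in>trivs D. \<forall>z\<in>patch c e.
       volume_ratio D \<tau> c e z = complex_of_real (Q \<tau>)) \<and>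
    (\<forall>\<tau>\<in>I. \<forall>c\<in>atlas D. \<forall>e\<in>trivs D. \<forall>z\<in>patch c e.
       scalar_curvature (base_metric D \<tau> c e) z = complex_of_real (poly P \<tau> / (2 * Q \<tau>))) \<and>
    (\<forall>\<phi> \<tau>\<^sub>0. momentum_profile I \<phi> \<longrightarrow> \<tau>\<^sub>0 \<in> interior I \<longrightarrow>
      (\<forall>c\<in>atlas D. \<forall>e\<in>trivs D.
       \<forall>y \<in> fst (bundle_chart D c e) \<inter> momentum_domain D I \<phi> \<tau>\<^sub>0.
         let \<tau> = momentum I \<phi> \<tau>\<^sub>0 (log_norm D y) in
         scalar_curvature (bundle_metric D I \<phi> \<tau>\<^sub>0 c e) (snd (bundle_chart D c e) y) =
           complex_of_real ((poly P \<tau> - deriv (deriv (\<lambda>s. Q s * \<phi> s)) \<tau>) / (2 * Q \<tau>))))"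
proof -
  have "\<exists>Q P :: real poly.
    (\<forall>\<tau>. \<forall>c\<in>atlas D. \<forall>e\<in>trivs D. \<forall>z\<in>patch c e. volume_ratio D \<tau> c e z = of_real (poly Q \<tau>)) \<and>
    (\<forall>\<tau>\<in>I. \<forall>c\<in>atlas D. \<forall>e\<in>trivs D. \<forall>z\<in>patch c e.
       scalar_curvature (base_metric D \<tau> c e) z = of_real (poly P \<tau> / (2 * poly Q \<tau>)))"
  \<comment> \<open>Both polynomials are read off at one point of one patch. If every patch is
    empty, the two claims are vacuous and any polynomials do.\<close>
  proof (cases "\<exists>c\<in>atlas D. \<exists>e\<in>trivs D. patch c e \<noteq> {}")
    case True
    then obtain c\<^sub>0 e\<^sub>0 z\<^sub>0 where 0: "c\<^sub>0 \<in> atlas D" "e\<^sub>0 \<in> trivs D" "z\<^sub>0 \<in> patch c\<^sub>0 e\<^sub>0" by blast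
    interpret p0: horizontal_patch D I c\<^sub>0 e\<^sub>0 by unfold_locales (use assms(1) 0 in auto)
    define Q where "Q = p0.volume_poly z\<^sub>0"
    define P where "P = p0.curvature_poly z\<^sub>0"
    have Q: "volume_ratio D \<tau> c e z = of_real (poly Q \<tau>)"
      if z: "c \<in> atlas D" "e \<in> trivs D" "z \<in> patch c e" for \<tau> c e z
    \<comment> \<open>The characteristic polynomial is evaluated at \<open>1 / \<tau>\<close>, so
      \<tau> = 0 is separate; there both volume ratios are 1.\<close>
    proof (cases "\<tau> = 0")
      interpret p: horizontal_patch D I c e by unfold_locales (use assms(1) z in auto)
      case False
      have "eigenvalues (form_endo (metric D c z) (curvature_form D c e z)) =
          eigenvalues (form_endo (metric D c\<^sub>0 z\<^sub>0) (curvature_form D c\<^sub>0 e\<^sub>0 z\<^sub>0))"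
        using assms(2) 0 z unfolding sigma_constant_def by metis
      then have "charpoly (form_endo (metric D c z) (curvature_form D c e z)) =
          charpoly (form_endo (metric D c\<^sub>0 z\<^sub>0) (curvature_form D c\<^sub>0 e\<^sub>0 z\<^sub>0))"
        by (rule charpoly_eqI)
      then have "volume_ratio D \<tau> c e z = volume_ratio D \<tau> c\<^sub>0 e\<^sub>0 z\<^sub>0"
        unfolding volume_ratio_def base_metric_def
        by (simp only: det_ratio_eq[OF p.det_metric_nonzero[OF z(3)] False]
            det_ratio_eq[OF p0.det_metric_nonzero[OF 0(3)] False])
      then show ?thesis using p0.volume_ratio_eq_poly[OF 0(3)] by (simp add: Q_def)
    next
      interpret p: horizontal_patch D I c e by unfold_locales (use assms(1) z in auto)
      case True
      then show ?thesis
        using p0.volume_ratio_eq_poly[OF 0(3), of 0] p.det_metric_nonzero[OF z(3)] p0.det_metric_nonzero[OF 0(3)]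
        by (simp add: Q_def volume_ratio_def base_metric_def)
    qed
    have P: "scalar_curvature (base_metric D \<tau> c e) z = of_real (poly P \<tau> / (2 * poly Q \<tau>))"
      if \<tau>: "\<tau> \<in> I" and z: "c \<in> atlas D" "e \<in> trivs D" "z \<in> patch c e" for \<tau> c e z
    proof -
      interpret q0: constant_volume_patch D I c\<^sub>0 e\<^sub>0 Q by unfold_locales (rule Q[OF 0(1,2)])
      have q: "poly Q \<tau> > 0" by (rule q0.Q_pos[OF \<tau> 0(3)])
      \<comment> \<open>Constancy of the scalar curvature for each \<tau> in \<open>I\<close>
        carries the polynomial found at \<open>z\<^sub>0\<close> to all other points, although the
        Ricci form itself may vary.\<close>
      have "scalar_curvature (base_metric D \<tau> c e) z = scalar_curvature (base_metric D \<tau> c\<^sub>0 e\<^sub>0) z\<^sub>0"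
        using assms(2) \<tau> 0 z unfolding sigma_constant_def by metis
      also have "\<dots> = trace (ricci_form (metric D c\<^sub>0) z\<^sub>0 ** matrix_inv (base_metric D \<tau> c\<^sub>0 e\<^sub>0 z\<^sub>0))"
        by (rule q0.scalar_curvature_base_metric[OF \<tau> 0(3)])
      finally have "of_real (poly P \<tau>) = 2 * of_real (poly Q \<tau>) * scalar_curvature (base_metric D \<tau> c e) z"
        using p0.curvature_poly_eq_trace[OF 0(3) positive_herm_det_nonzero[OF p0.base_metric_positive[OF \<tau> 0(3)]]]
        by (simp add: P_def Q[OF 0])
      then show ?thesis using q by (simp add: field_simps)
    qed
    show ?thesis using P Q by blast
  next
    case False
    then show ?thesis by blast
  qed
  then obtain Q P :: "real poly" where
    Q: "\<And>\<tau> c e z. c \<in> atlas D \<Longrightarrow> e \<in> trivs D \<Longrightarrow> z \<in> patch c e \<Longrightarrow> volume_ratio D \<tau> c e z = of_real (poly Q \<tau>)" and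
    P: "\<And>\<tau> c e z. \<tau> \<in> I \<Longrightarrow> c \<in> atlas D \<Longrightarrow> e \<in> trivs D \<Longrightarrow> z \<in> patch c e \<Longrightarrow>
       scalar_curvature (base_metric D \<tau> c e) z = of_real (poly P \<tau> / (2 * poly Q \<tau>))"
    by blast
  have main: "scalar_curvature (bundle_metric D I \<phi> \<tau>\<^sub>0 c e) (snd (bundle_chart D c e) y) =
      complex_of_real ((poly P \<tau> - deriv (deriv (\<lambda>s. poly Q s * \<phi> s)) \<tau>) / (2 * poly Q \<tau>))"
    if \<phi>: "momentum_profile I \<phi>" and \<tau>\<^sub>0: "\<tau>\<^sub>0 \<in> interior I" and c: "c \<in> atlas D" and e: "e \<in> trivs D"
      and y: "y \<in> fst (bundle_chart D c e)" "y \<in> momentum_domain D I \<phi> \<tau>\<^sub>0"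
      and \<tau>: "\<tau> = momentum I \<phi> \<tau>\<^sub>0 (log_norm D y)" for \<phi> \<tau>\<^sub>0 c e y \<tau>
  proof -
    obtain d where d: "d 0 = \<phi>"
      "\<And>k x. x \<in> closure I \<Longrightarrow> (d k has_real_derivative d (Suc k) x) (at x within closure I)"
      and pos: "\<And>x. x \<in> interior I \<Longrightarrow> 0 < \<phi> x"
      using \<phi> unfolding momentum_profile_def by blast
    have der: "(d k has_real_derivative d (Suc k) x) (at x)" if x: "x \<in> interior I" for k x
    proof -
      \<comment> \<open>The one-sided derivatives that define a profile on the closure become
        ordinary ones at interior points.\<close>
      have "x \<in> interior (closure I)" using x interior_mono[OF closure_subset] by blast
      then have "at x within closure I = at x" by (rule at_within_interior)
      moreover have "x \<in> closure I" using x interior_subset closure_subset by blast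
      ultimately show ?thesis using d(2)[of x k] by simp
    qed
    interpret momentum_patch D I c e Q \<phi> \<tau>\<^sub>0 "d 1" "d 2"
    proof unfold_locales
      show "is_interval I" using assms(1) by (simp add: horizontal_data_def)
      show "continuous_on (interior I) \<phi>"
        using der[of _ 0] d(1) by (intro continuous_at_imp_continuous_on ballI DERIV_isCont) auto
      show "(\<phi> has_real_derivative d 1 x) (at x)" if "x \<in> interior I" for x
        using der[OF that, of 0] d(1) by simp
      show "(d 1 has_real_derivative d 2 x) (at x)" if "x \<in> interior I" for x
        using der[OF that, of 1] by (simp add: numeral_2_eq_2)
    qed (use assms(1) c e Q \<tau>\<^sub>0 pos in auto)
    let ?w = "snd (bundle_chart D c e) y"
    have "normsq D y \<noteq> 0" and t: "log_norm D y \<in> times"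
      using y(2) by (auto simp: momentum_domain_def times_def)
    then have nz: "?w $ None \<noteq> 0" using normsq_eq[OF y(1)] by auto
    have t_eq: "log_norm D y = logn ?w" by (rule log_norm_eq[OF y(1) nz])
    have w: "?w \<in> region"
      using bundle_chart_patch[OF y(1)] nz t by (simp add: region_def punctured_def t_eq)
    show ?thesis
      unfolding \<tau> t_eq
      by (rule scalar_curvature_bundle_metric[OF w])
        (rule P[OF region_props(5)[OF w] c e region_props(1)[OF w]])
  qed
  show ?thesis
    unfolding Let_def using P Q main by (intro exI[of _ "poly Q"] exI[of _ P]) auto
qed

end
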